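(* Let $\Theta\subset\mathbb{R}^d$ be compact, let $\{\nu_\theta\}_{\theta\in\Theta}$ be a family of probability distributions on $(0,1)$, and let $\theta^\star$ be an interior point of $\Theta$. Let $X$ be the random walk in an i.i.d. random environment with marginal law $\nu_{\theta^\star}$, with annealed law $\mathbf{P}^\star:=\mathbf{P}^{\theta^\star}$. Assume: (1) for every $\theta\in\Theta$, $\mathbb{E}^\theta|\log\rho_0|<\infty$ and $\mathbb{E}^\theta(\log\rho_0)<0$; (2) for every $\theta\in\Theta$, $\mathbb{E}^\theta(\rho_0)<1$; (3) for every $x,y\in\mathbb{N}$, the map $\theta\mapsto\phi_\theta(x,y)$ is continuous on $\Theta$; (4) for all $\theta,\theta'\in\Theta$, $\nu_\theta\neq\nu_{\theta'}$ if and only if $\theta\neq\theta'$; (5) $\inf_{\theta\in\Theta}\mathbb{E}^\theta[\log(1-\omega_0)]>-\infty$. Then for any measurable choice of estimators $\widehat\theta_n\in\mathrm{Argmax}_{\theta\in\Theta}\,\ell_n(\theta)$, $n\ge 1$, we have $$\lim_{n\to\infty}\widehat\theta_n=\theta^\star\quad\text{in }\mathbf{P}^\star\text{-probability}.$$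
   Context: $\mathbb{N}=\{0,1,2,\dots\}$. For $\theta\in\Theta$, $\mathbb{P}^\theta=\nu_\theta^{\otimes\mathbb{Z}}$ is the law on $(0,1)^{\mathbb{Z}}$ of an i.i.d. environment $\omega=\{\omega_x\}_{x\in\mathbb{Z}}$ with marginal $\nu_\theta$, with expectation $\mathbb{E}^\theta$, and $\rho_x=(1-\omega_x)/\omega_x$. Given $\omega$, under the quenched law $P_\omega$, $X=\{X_t\}_{t\in\mathbb{N}}$ is the Markov chain on $\mathbb{Z}$ with $X_0=0$ that jumps from $x$ to $x+1$ with probability $\omega_x$ and to $x-1$ with probability $1-\omega_x$. The annealed law is $\mathbf{P}^\theta(\cdot)=\int P_\omega(\cdot)\,d\mathbb{P}^\theta(\omega)$. For $n\ge1$, $T_n=\inf\{t\in\mathbb{N}: X_t=n\}$ (a.s. finite under (1)), and for $x\in\mathbb{Z}$, $L_x^n=\sum_{s=0}^{T_n-1}\mathbf{1}\{X_s=x,\ X_{s+1}=x-1\}$ is the number of left steps from site $x$ before time $T_n$. For $x,y\in\mathbb{N}$, $$\phi_\theta(x,y)=\log\int_0^1 a^{x+1}(1-a)^y\,d\nu_\theta(a),\qquad \ell_n(\theta)=\sum_{x=0}^{n-1}\phi_\theta(L_{x+1}^n,L_x^n).$$ Under (3), $\ell_n$ is continuous on the compact set $\Theta$, so its maximum is attained (not necessarily at a unique point). *)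

theory Defs
  imports "HOL-Probability.Probability"
begin

abbreviation unit_borel :: "real measure" where
  "unit_borel \<equiv> restrict_space borel {0<..<1}"

abbreviation path_space :: "(nat \<Rightarrow> int) measure" where
  "path_space \<equiv> PiM UNIV (\<lambda>_. count_space UNIV)"

definition env_law :: "real measure \<Rightarrow> (int \<Rightarrow> real) measure" where
  "env_law \<mu> = PiM UNIV (\<lambda>_. \<mu>)"

definition odds :: "(int \<Rightarrow> real) \<Rightarrow> int \<Rightarrow> real" where
  "odds \<omega> x = (1 - \<omega> x) / \<omega> x"

text \<open>
  \<open>jump \<omega> x\<close> is the one-step transition law of the walk from site \<open>x\<close>. The quenched law is the
  law on path space produced by the Ionescu-Tulcea theorem from the kernels \<open>walk_kernel \<omega> t\<close>, the
  conditional law of \<open>X t\<close> given \<open>X 0, \<dots>, X (t - 1)\<close>.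
\<close>

definition jump :: "(int \<Rightarrow> real) \<Rightarrow> int \<Rightarrow> int pmf" where
  "jump \<omega> x = map_pmf (\<lambda>right. if right then x + 1 else x - 1) (bernoulli_pmf (\<omega> x))"

fun walk_kernel :: "(int \<Rightarrow> real) \<Rightarrow> nat \<Rightarrow> (nat \<Rightarrow> int) \<Rightarrow> int measure" where
  "walk_kernel \<omega> 0 X = measure_pmf (return_pmf 0)"
| "walk_kernel \<omega> (Suc t) X = measure_pmf (jump \<omega> (X t))"

lemma Ionescu_Tulcea_walk_kernel: "Ionescu_Tulcea (walk_kernel \<omega>) (\<lambda>_. count_space UNIV)"
proof (rule Ionescu_Tulcea.intro)
  fix i
  show "walk_kernel \<omega> i \<in> measurable (PiM {0..<i} (\<lambda>_. count_space UNIV)) (subprob_algebra (count_space UNIV))"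
  proof (cases i)
    case 0
    have "(\<lambda>X. measure_pmf (return_pmf (0::int))) \<in>
        measurable (PiM {0..<i} (\<lambda>_. count_space UNIV)) (subprob_algebra (count_space UNIV))"
      by (rule measurable_const) (rule measure_pmf_in_subprob_algebra)
    then show ?thesis
      by (simp add: 0 cong: measurable_cong)
  next
    case (Suc t)
    have "(\<lambda>X. measure_pmf (jump \<omega> (X t))) \<in>
        measurable (PiM {0..<i} (\<lambda>_. count_space UNIV)) (subprob_algebra (count_space UNIV))"
      by (rule measurable_compose[where N = "count_space UNIV"])
        (auto simp: Suc measure_pmf_in_subprob_algebra intro!: measurable_component_singleton)
    then show ?thesis
      by (simp add: Suc cong: measurable_cong)
  qed
next
  fix i X
  show "prob_space (walk_kernel \<omega> i X)"
    by (cases i) (auto intro: measure_pmf.prob_space_axioms)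
qed

interpretation quenched: Ionescu_Tulcea "walk_kernel \<omega>" "\<lambda>_. count_space UNIV" for \<omega>
  by (rule Ionescu_Tulcea_walk_kernel)

definition quenched_law :: "(int \<Rightarrow> real) \<Rightarrow> (nat \<Rightarrow> int) measure" where
  "quenched_law \<omega> = quenched.PF.lim \<omega>"

definition annealed_law :: "real measure \<Rightarrow> (nat \<Rightarrow> int) measure" where
  "annealed_law \<mu> = env_law \<mu> \<bind> quenched_law"

lemma sets_quenched_law [simp]: "sets (quenched_law \<omega>) = sets path_space"
  by (simp add: quenched_law_def)


lemma emeasure_C_singleton:
  "emeasure (quenched.C \<omega> 0 (Suc n) (\<lambda>_. undefined)) {restrict x {0..<Suc n}} =
    (if x 0 = 0 then ennreal (\<Prod>t<n. pmf (jump \<omega> (x t)) (x (Suc t))) else 0)"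
proof -
  let ?C = "\<lambda>n. quenched.C \<omega> 0 n (\<lambda>_. undefined)"
  let ?r = "\<lambda>n. restrict x {0..<n}"
  have sing: "{?r n} \<in> sets (PiM {0..<n} (\<lambda>_. count_space (UNIV :: int set)))" for n
  proof -
    have "(\<Pi>\<^sub>E i\<in>{0..<n}. {x i}) = {?r n}"
      by (auto simp: PiE_iff extensional_def fun_eq_iff restrict_def)
    then show ?thesis
      using sets_PiM_I_finite[of "{0..<n}" "\<lambda>i. {x i}" "\<lambda>_. count_space UNIV"] by simp
  qed
  have space_C: "space (?C n) = extensional {0..<n}" for n
    by (subst quenched.space_C) (auto simp: space_PiM PiE_def)
  have step: "emeasure (?C (Suc n)) {?r (Suc n)} =
      emeasure (?C n) {?r n} * emeasure (walk_kernel \<omega> n (?r n)) {x n}" for n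
  proof -
    have "emeasure (?C (Suc n)) {?r (Suc n)} =
        (\<integral>\<^sup>+X. emeasure (quenched.eP \<omega> n X) {?r (Suc n)} \<partial>?C n)"
      unfolding quenched.C.simps add_0
      by (rule emeasure_bind[where N = "PiM {0..<Suc n} (\<lambda>_. count_space UNIV)"])
        (use quenched.measurable_C[of \<omega> 0 n] quenched.measurable_eP[of \<omega> n] sing space_C in
          \<open>auto simp: measurable_cong_sets[OF quenched.sets_C refl] extensional_def\<close>)
    also have "\<dots> = (\<integral>\<^sup>+X. emeasure (walk_kernel \<omega> n (?r n)) {x n} * indicator {?r n} X \<partial>?C n)"
    proof (rule nn_integral_cong)
      fix X assume "X \<in> space (?C n)"
      then have X: "X \<in> extensional {0..<n}" by (simp add: space_C)
      have eq: "(\<lambda>y. X(n := y)) -` {?r (Suc n)} = (if X = ?r n then {x n} else {})"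
      proof (intro set_eqI)
        fix y
        have "X(n := y) = ?r (Suc n) \<longleftrightarrow> (X = ?r n \<and> y = x n)"
        proof
          assume eq: "X(n := y) = ?r (Suc n)"
          have "X t = ?r n t" for t
            using fun_cong[OF eq, of t] X by (cases "t < n") (auto simp: extensional_def)
          moreover have "y = x n"
            using fun_cong[OF eq, of n] by simp
          ultimately show "X = ?r n \<and> y = x n" by auto
        next
          assume "X = ?r n \<and> y = x n"
          then show "X(n := y) = ?r (Suc n)"
            by (auto simp: fun_eq_iff)
        qed
        then show "y \<in> (\<lambda>y. X(n := y)) -` {?r (Suc n)} \<longleftrightarrow> y \<in> (if X = ?r n then {x n} else {})"
          by auto
      qed
      have "emeasure (quenched.eP \<omega> n X) {?r (Suc n)} =
          emeasure (walk_kernel \<omega> n X) ((\<lambda>y. X(n := y)) -` {?r (Suc n)})"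
        using X sing by (subst quenched.emeasure_eP) (auto simp: space_PiM PiE_def)
      then show "emeasure (quenched.eP \<omega> n X) {?r (Suc n)} =
          emeasure (walk_kernel \<omega> n (?r n)) {x n} * indicator {?r n} X"
        by (simp add: eq)
    qed
    also have "\<dots> = emeasure (walk_kernel \<omega> n (?r n)) {x n} * emeasure (?C n) {?r n}"
      by (rule nn_integral_cmult_indicator) (subst quenched.sets_C; simp add: sing space_PiM)
    finally show ?thesis by (simp add: mult.commute)
  qed
  show ?thesis
  proof (induction n)
    case 0
    show ?case
      by (subst step) (auto simp: space_PiM emeasure_pmf_single indicator_def sing[of 0, simplified])
  next
    case (Suc n)
    have "emeasure (walk_kernel \<omega> (Suc n) (?r (Suc n))) {x (Suc n)} =
        ennreal (pmf (jump \<omega> (x n)) (x (Suc n)))"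
      by (simp add: emeasure_pmf_single)
    then show ?case
      by (subst step) (simp add: Suc ennreal_mult' prod_nonneg mult.commute del: quenched.C.simps)
  qed
qed

lemma emeasure_quenched_law_cylinder:
  "emeasure (quenched_law \<omega>) {X. \<forall>t\<le>n. X t = x t} =
    (if x 0 = 0 then ennreal (\<Prod>t<n. pmf (jump \<omega> (x t)) (x (Suc t))) else 0)"
proof -
  let ?J = "{0..<Suc n}"
  have PiE: "(\<Pi>\<^sub>E i\<in>?J. {x i}) = {restrict x ?J}"
    by (auto simp: PiE_iff extensional_def fun_eq_iff restrict_def)
  have sing: "{restrict x ?J} \<in> sets (PiM ?J (\<lambda>_. count_space (UNIV :: int set)))"
    using sets_PiM_I_finite[of ?J "\<lambda>i. {x i}" "\<lambda>_. count_space UNIV"] by (simp add: PiE)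
  have emb: "prod_emb ?J (\<lambda>_. count_space (UNIV :: int set)) ?J {restrict x ?J} = {restrict x ?J}"
    using sing by (intro prod_emb_id) (auto simp: space_PiM dest: sets.sets_into_space)
  have "restrict X ?J = restrict x ?J \<longleftrightarrow> (\<forall>t\<le>n. X t = x t)" for X
  proof
    assume eq: "restrict X ?J = restrict x ?J"
    show "\<forall>t\<le>n. X t = x t"
    proof safe
      fix t assume "t \<le> n"
      then show "X t = x t"
        using fun_cong[OF eq, of t] by simp
    qed
  qed (auto intro!: restrict_ext)
  then have "{X. \<forall>t\<le>n. X t = x t} =
      prod_emb UNIV (\<lambda>_. count_space UNIV) ?J {restrict x ?J}"
    by (simp add: prod_emb_def vimage_def)
  then show ?thesis
    unfolding quenched_law_def
    using quenched.lim[OF _ sing, of \<omega>] quenched.emeasure_CI[OF order_refl sing, of \<omega>]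
    by (simp only: emb emeasure_C_singleton finite_atLeastLessThan)
qed

lemma prob_space_quenched_law: "prob_space (quenched_law \<omega>)"
proof -
  interpret prob_space "quenched.CI \<omega> {}"
    by (rule quenched.PF.prob_space_P) auto
  have "space (quenched.CI \<omega> {}) \<in> sets (PiM {} (\<lambda>_. count_space UNIV))"
    by (simp add: quenched.PF.space_P)
  from quenched.lim[OF _ this, of \<omega>]
  have "emeasure (quenched_law \<omega>)
      (prod_emb UNIV (\<lambda>_. count_space UNIV) {} (space (quenched.CI \<omega> {}))) = 1"
    by (simp add: quenched_law_def emeasure_space_1 del: prod_emb_empty)
  moreover have "prod_emb UNIV (\<lambda>_. count_space UNIV) {} (space (quenched.CI \<omega> {})) =
      space (quenched_law \<omega>)"
    unfolding quenched_law_def by (simp add: quenched.PF.space_P prod_emb_def space_PiM)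
      (auto simp: restrict_def)
  ultimately show ?thesis
    by (intro prob_spaceI) simp
qed

lemma measurable_jump:
  "(\<lambda>\<omega>. measure_pmf (jump \<omega> i)) \<in>
    measurable (PiM UNIV (\<lambda>_. unit_borel)) (subprob_algebra (count_space UNIV))"
proof (rule measurable_subprob_algebra)
  fix A :: "int set"
  have coord: "(\<lambda>\<omega>. \<omega> i) \<in> borel_measurable (PiM UNIV (\<lambda>_. unit_borel))"
    using measurable_component_singleton[of i UNIV "\<lambda>_. unit_borel"]
    by (simp add: measurable_restrict_space2_iff)
  have "emeasure (jump \<omega> i) A =
      indicator A (i + 1) * ennreal (\<omega> i) + indicator A (i - 1) * ennreal (1 - \<omega> i)"
    if "\<omega> \<in> space (PiM UNIV (\<lambda>_. unit_borel))" for \<omega>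
  proof -
    have "0 < \<omega> i" "\<omega> i < 1"
      using that by (auto simp: space_PiM PiE_iff space_restrict_space)
    then show ?thesis
      unfolding jump_def by (subst nn_integral_indicator[symmetric]) auto
  qed
  then show "(\<lambda>\<omega>. emeasure (jump \<omega> i) A) \<in> borel_measurable (PiM UNIV (\<lambda>_. unit_borel))"
    using coord by (subst measurable_cong) auto
qed (auto intro: measure_pmf.subprob_space_axioms)

lemma measurable_quenched_law:
  "quenched_law \<in> measurable (PiM UNIV (\<lambda>_. unit_borel)) (prob_algebra path_space)"
proof -
  let ?\<Omega> = "PiM UNIV (\<lambda>_::int. unit_borel)"
  let ?P = "\<lambda>n. PiM {0..<n} (\<lambda>_. count_space (UNIV :: int set))"
  have ker: "(\<lambda>(\<omega>, X). walk_kernel \<omega> n X) \<in>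
      measurable (?\<Omega> \<Otimes>\<^sub>M ?P n) (subprob_algebra (count_space UNIV))" for n
  proof (cases n)
    case 0
    have "(\<lambda>p. measure_pmf (return_pmf (0::int))) \<in>
        measurable (?\<Omega> \<Otimes>\<^sub>M ?P n) (subprob_algebra (count_space UNIV))"
      by (rule measurable_const) (rule measure_pmf_in_subprob_algebra)
    then show ?thesis by (simp add: 0 split_beta')
  next
    case (Suc t)
    have "(\<lambda>p. measure_pmf (jump (fst p) (snd p t))) \<in>
        measurable (?\<Omega> \<Otimes>\<^sub>M ?P n) (subprob_algebra (count_space UNIV))"
    proof (rule measurable_compose_countable)
      show "(\<lambda>p. measure_pmf (jump (fst p) i)) \<in>
          measurable (?\<Omega> \<Otimes>\<^sub>M ?P n) (subprob_algebra (count_space UNIV))" for i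
        by (rule measurable_compose[OF measurable_fst measurable_jump])
      show "(\<lambda>p. snd p t) \<in> measurable (?\<Omega> \<Otimes>\<^sub>M ?P n) (count_space UNIV)"
        by (rule measurable_compose[OF measurable_snd]) (rule measurable_component_singleton, simp add: Suc)
    qed
    then show ?thesis by (simp add: Suc split_beta')
  qed
  have eP: "(\<lambda>(\<omega>, X). quenched.eP \<omega> n X) \<in>
      measurable (?\<Omega> \<Otimes>\<^sub>M ?P n) (subprob_algebra (?P (Suc n)))" for n
  proof -
    have upd: "(\<lambda>(p, y). (snd p)(n := y)) \<in>
        measurable ((?\<Omega> \<Otimes>\<^sub>M ?P n) \<Otimes>\<^sub>M count_space UNIV) (?P (Suc n))"
      unfolding split_beta'
      by (rule measurable_fun_upd[where J = "{0..<n}"]) (auto simp: measurable_component_singleton)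
    from measurable_distr2[OF this] ker[of n] show ?thesis
      by (simp add: quenched.eP_def split_beta')
  qed
  have C: "(\<lambda>\<omega>. quenched.C \<omega> 0 n (\<lambda>_. undefined)) \<in> measurable ?\<Omega> (subprob_algebra (?P n))" for n
  proof (induction n)
    case 0
    have "return (?P 0) (\<lambda>_. undefined) \<in> space (subprob_algebra (?P 0))"
      by (rule measurable_space[OF return_measurable]) (simp add: space_PiM PiE_iff extensional_def)
    then show ?case by simp
  next
    case (Suc n)
    have "(\<lambda>\<omega>. quenched.C \<omega> 0 n (\<lambda>_. undefined) \<bind> quenched.eP \<omega> n) \<in>
        measurable ?\<Omega> (subprob_algebra (?P (Suc n)))"
      using eP[of n] by (intro measurable_bind[OF Suc]) (simp add: split_beta')
    then show ?case by simp
  qed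
  show ?thesis
  proof (rule measurable_prob_algebra_generated[OF quenched.PF.sets_PiM_generator])
    show "Int_stable quenched.PF.generator"
      using quenched.PF.algebra_generator by (auto simp: Int_stable_def algebra_iff_Int)
    show "quenched.PF.generator \<subseteq> Pow (space path_space)"
      using quenched.PF.algebra_generator by (auto simp: algebra_iff_Int)
    fix A assume "A \<in> quenched.PF.generator"
    then obtain J X where J: "finite J" and X: "X \<in> sets (PiM J (\<lambda>_. count_space UNIV))"
      and A: "A = prod_emb UNIV (\<lambda>_. count_space UNIV) J X"
      by (auto elim: quenched.PF.generator.cases)
    obtain n where n: "J \<subseteq> {0..<n}"
      using J finite_nat_set_iff_bounded by (auto simp: subset_eq)
    have "emeasure (quenched_law \<omega>) A = emeasure (quenched.C \<omega> 0 n (\<lambda>_. undefined))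
        (prod_emb {0..<n} (\<lambda>_. count_space UNIV) J X)" for \<omega>
      unfolding quenched_law_def A using quenched.lim[OF J X, of \<omega>] quenched.emeasure_CI[OF n X, of \<omega>]
      by simp
    moreover have "prod_emb {0..<n} (\<lambda>_. count_space UNIV) J X \<in> sets (?P n)"
      using n X by (rule measurable_prod_emb)
    ultimately show "(\<lambda>\<omega>. emeasure (quenched_law \<omega>) A) \<in> borel_measurable ?\<Omega>"
      using measurable_emeasure_kernel[OF C[of n]] by simp
  qed (auto intro: prob_space_quenched_law)
qed

lemma env_law_props:
  assumes "prob_space \<mu>" "sets \<mu> = sets unit_borel"
  shows "env_law \<mu> \<in> space (prob_algebra (PiM UNIV (\<lambda>_. unit_borel)))"
  using assms
  by (auto simp: env_law_def space_prob_algebra intro!: prob_space_PiM sets_PiM_cong)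

lemma prob_space_annealed_law:
  assumes "prob_space \<mu>" "sets \<mu> = sets unit_borel"
  shows "prob_space (annealed_law \<mu>)"
  using prob_space_bind'[OF env_law_props[OF assms] measurable_quenched_law]
  by (simp add: annealed_law_def)

lemma emeasure_annealed_law:
  assumes "prob_space \<mu>" "sets \<mu> = sets unit_borel" "A \<in> sets path_space"
  shows "emeasure (annealed_law \<mu>) A = (\<integral>\<^sup>+\<omega>. emeasure (quenched_law \<omega>) A \<partial>env_law \<mu>)"
  unfolding annealed_law_def
  using emeasure_bind_prob_algebra[OF env_law_props[OF assms(1,2)] measurable_quenched_law assms(3)] .

text \<open>
  \<open>hit X n\<close> is infinite if \<open>X\<close> never visits \<open>n\<close>; \<open>left_steps X n x\<close> and the log-likelihood are
  meaningful only when it is finite, which holds almost surely for the walks considered here.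
\<close>

definition hit :: "(nat \<Rightarrow> int) \<Rightarrow> nat \<Rightarrow> enat" where
  "hit X n = (INF t\<in>{t. X t = int n}. enat t)"

definition left_steps :: "(nat \<Rightarrow> int) \<Rightarrow> nat \<Rightarrow> int \<Rightarrow> nat" where
  "left_steps X n x = (\<Sum>s | enat s < hit X n. of_bool (X s = x \<and> X (Suc s) = x - 1))"

definition log_moment :: "real measure \<Rightarrow> nat \<Rightarrow> nat \<Rightarrow> real" where
  "log_moment \<mu> x y = ln (\<integral>a. a ^ (x + 1) * (1 - a) ^ y \<partial>\<mu>)"

definition log_likelihood :: "('p \<Rightarrow> real measure) \<Rightarrow> (nat \<Rightarrow> int) \<Rightarrow> nat \<Rightarrow> 'p \<Rightarrow> real" where
  "log_likelihood \<nu> X n \<theta> =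
    (\<Sum>x<n. log_moment (\<nu> \<theta>) (left_steps X n (int x + 1)) (left_steps X n (int x)))"

end

theory Submission
  imports Defs "HOL-Real_Asymp.Real_Asymp"
begin

text \<open>
  The counts of left steps, read from the target \<open>n\<close> down to the origin, form under the annealed law
  a Markov chain started at 0 (a branching process in random environment with one immigrant per generation), and
  the log-likelihood is, up to binomial coefficients free of the parameter, that of the chain. So the claim is
  about maximum likelihood for a Markov chain, and for any compact set \<open>K\<close> of parameters without
  \<open>\<theta>\<^sub>0\<close> it has to be shown that with high probability no parameter in \<open>K\<close>
  is at least as likely as \<open>\<theta>\<^sub>0\<close>.

  The reduction to the chain rests on two functionals of the walk in a fixed environment. The conditional
  probability of a given final profile of left steps, written down explicitly as a product of negative binomial
  weights, is superharmonic, which bounds the probability of each profile (\<open>emeasure_left_counts_le\<close>,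
  \<open>emeasure_left_profile_chain\<close>). The time elapsed plus the expected time to go is superharmonic too;
  its annealed mean is finite as the mean odds are below 1, so that \<open>n\<close> is reached almost surely
  (\<open>emeasure_never_reached\<close>).

  For the chain, consider the product over the steps of the cube root of the likelihood ratio, divided at each
  step from \<open>x\<close> by an upper bound for its conditional mean
  \<open>\<Sum>y. p x y powr (2/3) * q x y powr (1/3)\<close>. This product is a supermartingale, so it is rarely
  large. The conditional mean is strictly less than 1 at every \<open>x\<close>, because the transition
  probabilities from \<open>x\<close> are moments that determine the site law
  (\<open>moments_determine_site_law\<close>). It stays below \<open>exp (c * (\<tau> * x - 1))\<close> for some
  \<open>c > 0\<close>, even if \<open>q\<close> is replaced by an upper bound valid in a neighbourhood of the
  parameter (\<open>envelope_affinity_bound\<close>). Hence a likelihood ratio that is at least 1 somewhere in the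
  neighbourhood forces either an event of probability at most \<open>exp (- c * n / 2)\<close> or a sum of the
  first \<open>n\<close> states larger than \<open>n / (2 * \<tau>)\<close>
  (\<open>local_likelihood_bound\<close>). The second event is common to all parameters and has probability at
  most \<open>2 * \<tau> * M\<close>, where \<open>M\<close> bounds the means of the states. Covering
  \<open>K\<close> by finitely many neighbourhoods, and then letting \<open>n\<close> tend to infinity and
  \<open>\<tau>\<close> to 0, gives the claim (\<open>chain_likelihood_separated\<close>).
\<close>

section \<open>The transition probabilities of the chain\<close>

locale site_law = prob_space \<mu> for \<mu> :: "real measure" +
  assumes sets_site: "sets \<mu> = sets unit_borel"
begin

lemma space_site: "space \<mu> = {0<..<1}"
  using sets_eq_imp_space_eq[OF sets_site] by (simp add: space_restrict_space)

lemma measurable_site: "f \<in> borel_measurable borel \<Longrightarrow> f \<in> borel_measurable \<mu>"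
  using measurable_restrict_space1[of f borel borel "{0<..<1}"]
  by (subst measurable_cong_sets[OF sets_site refl])

lemma integrable_site:
  fixes f :: "real \<Rightarrow> real"
  assumes "f \<in> borel_measurable borel" and "\<And>a. 0 < a \<Longrightarrow> a < 1 \<Longrightarrow> \<bar>f a\<bar> \<le> B"
  shows "integrable \<mu> f"
  using assms by (intro integrable_const_bound[where B = B] measurable_site AE_I2) (auto simp: space_site)

lemma integrable_moment: "integrable \<mu> (\<lambda>a. a ^ x * (1 - a) ^ y)"
  by (rule integrable_site[where B = 1]) (auto simp: abs_mult power_le_one mult_le_one)

end

text \<open>
  The transition probabilities of the left-step counts, read from site \<open>n\<close> down to \<open>0\<close>:
  if the walk makes \<open>x\<close> left steps from \<open>j + 1\<close>, it makes \<open>x + 1\<close> right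
  steps from \<open>j\<close>, and its left steps from \<open>j\<close> are the failures before the last of these
  successes. The environment at \<open>j\<close> is then averaged out.
\<close>

definition step_prob :: "real measure \<Rightarrow> nat \<Rightarrow> nat \<Rightarrow> real" where
  "step_prob \<mu> x y = (\<integral>a. pmf (neg_binomial_pmf (Suc x) a) y \<partial>\<mu>)"

definition step_pmf :: "real measure \<Rightarrow> nat \<Rightarrow> nat pmf" where
  "step_pmf \<mu> x = embed_pmf (step_prob \<mu> x)"

lemma pmf_neg_binomial_Suc:
  "0 < a \<Longrightarrow> a < 1 \<Longrightarrow>
    pmf (neg_binomial_pmf (Suc x) a) y = real ((x + y) choose y) * (a ^ (x + 1) * (1 - a) ^ y)"
  by (subst pmf_neg_binomial) (auto simp: add.commute)

context site_law begin

lemma step_prob_eq: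
  "step_prob \<mu> x y = real ((x + y) choose y) * (\<integral>a. a ^ (x + 1) * (1 - a) ^ y \<partial>\<mu>)"
proof -
  have "step_prob \<mu> x y = (\<integral>a. real ((x + y) choose y) * (a ^ (x + 1) * (1 - a) ^ y) \<partial>\<mu>)"
    unfolding step_prob_def
    by (intro Bochner_Integration.integral_cong refl pmf_neg_binomial_Suc) (simp_all add: space_site)
  then show ?thesis by simp
qed

lemma moment_pos: "0 < (\<integral>a. a ^ (x + 1) * (1 - a) ^ y \<partial>\<mu>)"
proof -
  have "(\<integral>a. 0 \<partial>\<mu>) < (\<integral>a. a ^ (x + 1) * (1 - a) ^ y \<partial>\<mu>)"
    by (rule integral_less_AE_space[OF _ integrable_moment])
      (use emeasure_space_1 in \<open>auto simp: space_site intro!: AE_I2\<close>)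
  then show ?thesis by simp
qed

lemma step_prob_pos: "0 < step_prob \<mu> x y"
  using moment_pos[of x y] by (simp add: step_prob_eq del: power_Suc)

lemma step_prob_log_moment: "step_prob \<mu> x y = real ((x + y) choose y) * exp (log_moment \<mu> x y)"
  using moment_pos[of x y] by (simp add: step_prob_eq log_moment_def del: power_Suc)

lemma nn_step_prob: "ennreal (step_prob \<mu> x y) = (\<integral>\<^sup>+a. pmf (neg_binomial_pmf (Suc x) a) y \<partial>\<mu>)"
proof -
  have "integrable \<mu> (\<lambda>a. real ((x + y) choose y) * (a ^ (x + 1) * (1 - a) ^ y))"
    by (intro integrable_mult_right integrable_moment)
  then have "integrable \<mu> (\<lambda>a. pmf (neg_binomial_pmf (Suc x) a) y)"
    by (subst Bochner_Integration.integrable_cong[OF refl, where g = "\<lambda>a. real ((x + y) choose y) * (a ^ (x + 1) * (1 - a) ^ y)"])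
      (auto simp: space_site pmf_neg_binomial_Suc simp del: power_Suc)
  then show ?thesis
    unfolding step_prob_def by (intro nn_integral_eq_integral[symmetric]) auto
qed

lemma measurable_neg_binomial: "(\<lambda>a. pmf (neg_binomial_pmf n a) y) \<in> borel_measurable \<mu>"
proof -
  have "(\<lambda>a. real ((y + n - 1) choose y) * a ^ n * (1 - a) ^ y) \<in> borel_measurable \<mu>"
    by (rule measurable_site) simp
  then show ?thesis
    by (subst measurable_cong) (simp_all add: space_site pmf_neg_binomial)
qed

lemma nn_step_mixture:
  "(\<integral>\<^sup>+y. ennreal (step_prob \<mu> x y) * f y \<partial>count_space UNIV) =
    (\<integral>\<^sup>+a. (\<integral>\<^sup>+y. f y \<partial>neg_binomial_pmf (Suc x) a) \<partial>\<mu>)"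
proof -
  have "(\<integral>\<^sup>+y. ennreal (step_prob \<mu> x y) * f y \<partial>count_space UNIV) =
      (\<integral>\<^sup>+y. (\<integral>\<^sup>+a. ennreal (pmf (neg_binomial_pmf (Suc x) a) y) * f y \<partial>\<mu>) \<partial>count_space UNIV)"
    by (intro nn_integral_cong) (simp add: nn_step_prob nn_integral_multc measurable_neg_binomial)
  also have "\<dots> = (\<integral>\<^sup>+a. (\<integral>\<^sup>+y. ennreal (pmf (neg_binomial_pmf (Suc x) a) y) * f y \<partial>count_space UNIV) \<partial>\<mu>)"
    unfolding nn_integral_count_space_nat
    by (subst nn_integral_suminf) (auto intro!: borel_measurable_times measurable_compose[OF measurable_neg_binomial])
  finally show ?thesis
    by (simp add: nn_integral_measure_pmf)
qed

lemma pmf_step_pmf: "pmf (step_pmf \<mu> x) y = step_prob \<mu> x y"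
  unfolding step_pmf_def
proof (rule pmf_embed_pmf)
  show "0 \<le> step_prob \<mu> x y" for y
    using step_prob_pos[of x y] by simp
  show "(\<integral>\<^sup>+y. ennreal (step_prob \<mu> x y) \<partial>count_space UNIV) = 1"
    using nn_step_mixture[of x "\<lambda>_. 1"]
    by (simp add: measure_pmf.emeasure_space_1[simplified] emeasure_space_1)
qed

lemma nn_integral_step_pmf:
  "(\<integral>\<^sup>+y. f y \<partial>step_pmf \<mu> x) = (\<integral>\<^sup>+a. (\<integral>\<^sup>+y. f y \<partial>neg_binomial_pmf (Suc x) a) \<partial>\<mu>)"
  unfolding nn_integral_measure_pmf[of "step_pmf \<mu> x"] by (simp add: pmf_step_pmf nn_step_mixture)

text \<open>
  One step multiplies \<open>x + 1\<close>, and not \<open>x\<close>, by the mean odds: this is a branching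
  process with one immigrant per generation.
\<close>

lemma mean_step_pmf:
  "(\<integral>\<^sup>+y. of_nat y \<partial>step_pmf \<mu> x) = of_nat (Suc x) * (\<integral>\<^sup>+a. ennreal ((1 - a) / a) \<partial>\<mu>)"
proof -
  have "(\<integral>\<^sup>+y. of_nat y \<partial>step_pmf \<mu> x) = (\<integral>\<^sup>+a. of_nat (Suc x) * ennreal ((1 - a) / a) \<partial>\<mu>)"
    unfolding nn_integral_step_pmf
  proof (rule nn_integral_cong)
    fix a assume "a \<in> space \<mu>"
    then have a: "0 < a" "a < 1" by (auto simp: space_site)
    have "(\<integral>\<^sup>+y. of_nat y \<partial>neg_binomial_pmf (Suc x) a) = ennreal (real (Suc x) * ((1 - a) / a))"
      using a by (subst nn_integral_neg_binomial_pmf_real) auto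
    also have "\<dots> = of_nat (Suc x) * ennreal ((1 - a) / a)"
      by (subst ennreal_mult) (use a in \<open>auto simp: ennreal_of_nat_eq_real_of_nat\<close>)
    finally show "(\<integral>\<^sup>+y. of_nat y \<partial>neg_binomial_pmf (Suc x) a) = \<dots>" .
  qed
  then show ?thesis
    by (simp add: nn_integral_cmult measurable_site)
qed

lemma nn_integral_env_law_prod:
  assumes "finite J" and "\<And>j. j \<in> J \<Longrightarrow> f j \<in> borel_measurable \<mu>"
  shows "(\<integral>\<^sup>+\<omega>. (\<Prod>j\<in>J. f j (\<omega> j)) \<partial>env_law \<mu>) = (\<Prod>j\<in>J. \<integral>\<^sup>+a. f j a \<partial>\<mu>)"
proof -
  interpret P: product_prob_space "\<lambda>_::int. \<mu>" UNIV ..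
  have meas: "(\<lambda>\<omega>. \<Prod>j\<in>J. f j (\<omega> j)) \<in> borel_measurable (PiM J (\<lambda>_. \<mu>))"
    using assms by (intro borel_measurable_prod_ennreal measurable_compose[OF measurable_component_singleton]) auto
  have "(\<integral>\<^sup>+\<omega>. (\<Prod>j\<in>J. f j (\<omega> j)) \<partial>env_law \<mu>) =
      (\<integral>\<^sup>+\<omega>. (\<Prod>j\<in>J. f j (restrict \<omega> J j)) \<partial>env_law \<mu>)"
    by (intro nn_integral_cong prod.cong) auto
  also have "\<dots> = (\<integral>\<^sup>+\<omega>. (\<Prod>j\<in>J. f j (\<omega> j)) \<partial>PiM J (\<lambda>_. \<mu>))"
    unfolding env_law_def
    by (subst P.distr_PiM_restrict_finite[OF assms(1) subset_UNIV, symmetric], subst nn_integral_distr)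
      (auto intro: measurable_restrict_subset meas)
  also have "\<dots> = (\<Prod>j\<in>J. \<integral>\<^sup>+a. f j a \<partial>\<mu>)"
    using assms by (rule P.product_nn_integral_prod)
  finally show ?thesis .
qed

end

section \<open>The law of the past of the walk\<close>

text \<open>
  Pasts are kept most recent position first, so that a step of the walk is a \<open>Cons\<close> and the current
  position is the head.
\<close>

primrec past :: "nat \<Rightarrow> (nat \<Rightarrow> int) \<Rightarrow> int list" where
  "past 0 X = [X 0]"
| "past (Suc t) X = X (Suc t) # past t X"

primrec walk_pmf :: "(int \<Rightarrow> real) \<Rightarrow> nat \<Rightarrow> int list pmf" where
  "walk_pmf \<omega> 0 = return_pmf [0]"
| "walk_pmf \<omega> (Suc t) = bind_pmf (walk_pmf \<omega> t) (\<lambda>xs. map_pmf (\<lambda>y. y # xs) (jump \<omega> (hd xs)))"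

lemma hd_past [simp]: "hd (past t X) = X t"
  by (cases t) auto

lemma past_not_Nil [simp]: "past t X \<noteq> []"
  by (cases t) auto

lemma length_past [simp]: "length (past t X) = Suc t"
  by (induction t) auto

lemma set_past: "set (past t X) = X ` {..t}"
  by (induction t) (auto simp: atMost_Suc)

lemma past_eq_iff: "past t X = past t Y \<longleftrightarrow> (\<forall>s\<le>t. X s = Y s)"
  by (induction t) (auto simp: le_Suc_eq)

lemma measurable_past: "past t \<in> measurable path_space (count_space UNIV)"
proof (induction t)
  case 0
  have "(\<lambda>X. [X 0]) \<in> measurable path_space (count_space UNIV)"
    by (rule measurable_compose[where N = "count_space UNIV"]) (auto intro: measurable_component_singleton)
  then show ?case by simp
next
  case (Suc t)
  have "(\<lambda>X. X (Suc t) # past t X) \<in> measurable path_space (count_space UNIV)"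
  proof (rule measurable_compose_countable[OF _ Suc, where f = "\<lambda>xs X. X (Suc t) # xs"])
    show "(\<lambda>X. X (Suc t) # xs) \<in> measurable path_space (count_space UNIV)" for xs
      by (rule measurable_compose[where N = "count_space UNIV"]) (auto intro: measurable_component_singleton)
  qed
  then show ?case by simp
qed

lemma measurable_quenched_past: "past t \<in> measurable (quenched_law \<omega>) (count_space UNIV)"
  by (subst measurable_cong_sets[OF sets_quenched_law refl]) (rule measurable_past)

lemma pmf_bind_Cons:
  "pmf (bind_pmf p (\<lambda>l. map_pmf (\<lambda>y. y # l) (q l))) (y # l) = pmf p l * pmf (q l) y"
proof -
  have "pmf (map_pmf (\<lambda>y. y # zs) p) (y # l) = indicator {l} zs * pmf p y" for zs and p :: "'a pmf"
  proof (cases "zs = l")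
    case True
    then show ?thesis
      using pmf_map_inj'[of "\<lambda>y. y # l" p y] by (simp add: inj_def)
  next
    case False
    then show ?thesis
      by (simp add: pmf_map_outside image_iff)
  qed
  then have "pmf (bind_pmf p (\<lambda>l. map_pmf (\<lambda>y. y # l) (q l))) (y # l) =
      (\<integral>zs. pmf (q l) y * indicator {l} zs \<partial>p)"
    unfolding pmf_bind
    by (intro Bochner_Integration.integral_cong refl) (simp add: indicator_def)
  then show ?thesis
    by (simp add: measure_pmf_single mult.commute)
qed

lemma pmf_walk_pmf_Cons:
  "pmf (walk_pmf \<omega> (Suc t)) (y # xs) = pmf (walk_pmf \<omega> t) xs * pmf (jump \<omega> (hd xs)) y"
  by (simp add: pmf_bind_Cons)

lemma pmf_walk_pmf_past:
  "pmf (walk_pmf \<omega> t) (past t x) = (if x 0 = 0 then \<Prod>s<t. pmf (jump \<omega> (x s)) (x (Suc s)) else 0)"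
proof (induction t)
  case (Suc t)
  then show ?case
    by (simp add: pmf_walk_pmf_Cons del: walk_pmf.simps)
qed (auto simp: indicator_def)

lemma set_walk_pmf: "set_pmf (walk_pmf \<omega> t) \<subseteq> range (past t)"
proof (induction t)
  case 0
  then show ?case by (auto intro!: image_eqI[where x = "\<lambda>_. 0"])
next
  case (Suc t)
  have "y # past t x = past (Suc t) (x(Suc t := y))" for x y
    by (simp add: past_eq_iff)
  with Suc show ?case by (auto simp del: past.simps)
qed

lemma distr_past: "distr (quenched_law \<omega>) (count_space UNIV) (past t) = measure_pmf (walk_pmf \<omega> t)"
proof (rule measure_eqI_countable_AE[where \<Omega> = "range (past t)"])
  note meas = measurable_quenched_past[of t \<omega>]
  show "AE xs in distr (quenched_law \<omega>) (count_space UNIV) (past t). xs \<in> range (past t)"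
    by (subst AE_distr_iff[OF meas]) auto
  show "AE xs in walk_pmf \<omega> t. xs \<in> range (past t)"
    using set_walk_pmf by (auto simp: AE_measure_pmf_iff)
  fix xs assume "xs \<in> range (past t)"
  then obtain x where x: "xs = past t x" by auto
  have "space (quenched_law \<omega>) = UNIV"
    using sets_eq_imp_space_eq[OF sets_quenched_law] by (simp add: space_PiM)
  then show "emeasure (distr (quenched_law \<omega>) (count_space UNIV) (past t)) {xs} =
      emeasure (walk_pmf \<omega> t) {xs}"
    unfolding x
    by (subst emeasure_distr[OF meas])
      (auto simp: vimage_def past_eq_iff emeasure_quenched_law_cylinder emeasure_pmf_single pmf_walk_pmf_past)
qed auto

lemma nn_integral_past:
  "(\<integral>\<^sup>+X. F (past t X) \<partial>quenched_law \<omega>) = (\<integral>\<^sup>+xs. F xs \<partial>walk_pmf \<omega> t)"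
  unfolding distr_past[symmetric]
  by (subst nn_integral_distr[OF measurable_quenched_past]) simp_all

text \<open>
  All quenched estimates below come from this principle: a functional of the past that loses in the mean at every
  step is bounded in the mean by its initial value.
\<close>

lemma nn_integral_past_le:
  fixes F :: "int list \<Rightarrow> ennreal"
  assumes \<omega>: "\<And>x. 0 < \<omega> x \<and> \<omega> x < 1"
    and super: "\<And>x xs. ennreal (\<omega> x) * F ((x + 1) # x # xs) + ennreal (1 - \<omega> x) * F ((x - 1) # x # xs) \<le> F (x # xs)"
  shows "(\<integral>\<^sup>+X. F (past t X) \<partial>quenched_law \<omega>) \<le> F [0]"
proof -
  have "(\<integral>\<^sup>+xs. F xs \<partial>walk_pmf \<omega> t) \<le> F [0]"
  proof (induction t)
    case (Suc t)
    have "(\<integral>\<^sup>+xs. F xs \<partial>walk_pmf \<omega> (Suc t)) = (\<integral>\<^sup>+xs. (\<integral>\<^sup>+y. F (y # xs) \<partial>jump \<omega> (hd xs)) \<partial>walk_pmf \<omega> t)"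
      by simp
    also have "\<dots> \<le> (\<integral>\<^sup>+xs. F xs \<partial>walk_pmf \<omega> t)"
    proof (intro nn_integral_mono_AE AE_pmfI)
      fix xs assume "xs \<in> set_pmf (walk_pmf \<omega> t)"
      then have "xs \<in> range (past t)" using set_walk_pmf by blast
      then have "xs \<noteq> []" by auto
      then obtain x ys where xs: "xs = x # ys" by (cases xs) auto
      have "(\<integral>\<^sup>+y. F (y # xs) \<partial>jump \<omega> x) =
          ennreal (\<omega> x) * F ((x + 1) # x # ys) + ennreal (1 - \<omega> x) * F ((x - 1) # x # ys)"
        using \<omega>[of x] by (simp add: jump_def xs mult.commute)
      then show "(\<integral>\<^sup>+y. F (y # xs) \<partial>jump \<omega> (hd xs)) \<le> F xs"
        using super[of x ys] by (simp add: xs)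
    qed
    finally show ?case using Suc by simp
  qed simp
  then show ?thesis by (simp add: nn_integral_past)
qed

section \<open>Left-step counts in a fixed environment\<close>

lemma space_quenched_law: "space (quenched_law \<omega>) = UNIV"
  using sets_eq_imp_space_eq[OF sets_quenched_law] by (simp add: space_PiM)

lemma emeasure_past:
  "emeasure (quenched_law \<omega>) (past t -` A) = (\<integral>\<^sup>+X. indicator A (past t X) \<partial>quenched_law \<omega>)"
proof -
  have "past t -` A \<in> sets (quenched_law \<omega>)"
    using measurable_sets[OF measurable_quenched_past, of A t \<omega>] by (simp add: space_quenched_law)
  then have "emeasure (quenched_law \<omega>) (past t -` A) = (\<integral>\<^sup>+X. indicator (past t -` A) X \<partial>quenched_law \<omega>)"
    by (rule nn_integral_indicator[symmetric])
  moreover have "indicator (past t -` A) X = (indicator A (past t X) :: ennreal)" for X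
    by (simp add: indicator_def)
  ultimately show ?thesis by simp
qed

text \<open>
  Counting stops at the first visit to \<open>n\<close>, so that the count is final once \<open>n\<close> occurs
  in the past.
\<close>

primrec left_count :: "nat \<Rightarrow> int list \<Rightarrow> int \<Rightarrow> nat" where
  "left_count n [] j = 0"
| "left_count n (y # xs) j =
    left_count n xs j + of_bool (xs \<noteq> [] \<and> int n \<notin> set xs \<and> hd xs = j \<and> y = j - 1)"

lemma left_count_past:
  "left_count n (past t X) j = (\<Sum>s | s < t \<and> int n \<notin> X ` {..s}. of_bool (X s = j \<and> X (Suc s) = j - 1))"
proof (induction t)
  case (Suc t)
  have "{s. s < Suc t \<and> int n \<notin> X ` {..s}} = {s. s < t \<and> int n \<notin> X ` {..s}} \<union> (if int n \<notin> X ` {..t} then {t} else {})"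
    by (auto simp: less_Suc_eq)
  moreover have "finite {s. s < t \<and> int n \<notin> X ` {..s}}" by simp
  ultimately show ?case
    using Suc by (auto simp: set_past sum.insert_if)
qed simp

lemma reached_iff: "int n \<in> X ` {..s} \<longleftrightarrow> (\<exists>r\<le>s. X r = int n)"
  by (auto simp: image_iff Bex_def eq_commute[of "int n"])

lemma enat_less_hit_iff: "enat s < hit X n \<longleftrightarrow> int n \<notin> X ` {..s}"
proof -
  have "hit X n \<le> enat s \<longleftrightarrow> (\<exists>r\<le>s. X r = int n)"
  proof
    assume le: "hit X n \<le> enat s"
    have "enat ` {r. X r = int n} \<noteq> {}"
    proof
      assume "enat ` {r. X r = int n} = {}"
      then have "hit X n = \<infinity>" by (simp add: hit_def Inf_enat_def)
      with le show False by simp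
    qed
    then have "hit X n \<in> enat ` {r. X r = int n}"
      unfolding hit_def by (metis Inf_enat_def LeastI_ex ex_in_conv)
    with le show "\<exists>r\<le>s. X r = int n" by auto
  next
    assume "\<exists>r\<le>s. X r = int n"
    then obtain r where "r \<le> s" "X r = int n" by auto
    then have "hit X n \<le> enat r" unfolding hit_def by (intro INF_lower) simp
    with \<open>r \<le> s\<close> show "hit X n \<le> enat s" by (meson enat_ord_simps(1) order_trans)
  qed
  then have "enat s < hit X n \<longleftrightarrow> \<not> (\<exists>r\<le>s. X r = int n)" by (simp add: not_le[symmetric])
  then show ?thesis by (simp only: reached_iff)
qed

lemma left_steps_eq_left_count:
  assumes "int n \<in> X ` {..t}"
  shows "left_steps X n j = left_count n (past t X) j"
proof -
  have "int n \<in> X ` {..s}" if "t \<le> s" for s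
    using assms that by (meson atMost_subset_iff image_mono subsetD)
  then have "{s. int n \<notin> X ` {..s}} = {s. s < t \<and> int n \<notin> X ` {..s}}"
    by (auto simp: not_le[symmetric])
  then show ?thesis
    by (simp add: left_steps_def left_count_past enat_less_hit_iff)
qed

lemma left_steps_target [simp]: "left_steps X n (int n) = 0"
  unfolding left_steps_def by (rule sum.neutral) (auto simp: enat_less_hit_iff reached_iff)

text \<open>
  Conditioning on whether the first trial is a success.
\<close>

lemma pmf_neg_binomial_step:
  assumes "0 < p" "p < 1"
  shows "pmf (neg_binomial_pmf (Suc m) p) k =
    p * pmf (neg_binomial_pmf m p) k + (1 - p) * (if k > 0 then pmf (neg_binomial_pmf (Suc m) p) (k - 1) else 0)"
proof -
  have shift: "pmf (map_pmf Suc q) k = (if k > 0 then pmf q (k - 1) else 0)" for q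
    using pmf_map_inj'[of Suc q "k - 1"] by (cases k) (auto simp: pmf_map_outside)
  have "pmf (neg_binomial_pmf (Suc m) p) k =
      pmf (bernoulli_pmf p \<bind> (\<lambda>b. if b then neg_binomial_pmf m p else map_pmf Suc (neg_binomial_pmf (Suc m) p))) k"
    using assms by (subst neg_binomial_pmf_unfold) auto
  also have "\<dots> = p * pmf (neg_binomial_pmf m p) k + (1 - p) * pmf (map_pmf Suc (neg_binomial_pmf (Suc m) p)) k"
    using assms by (simp add: pmf_bind)
  finally show ?thesis by (simp add: shift)
qed

text \<open>
  For a walk standing at \<open>x\<close>, the probability that it still makes \<open>l j\<close> left steps from
  \<open>j\<close> before reaching its target, given that it still makes \<open>l (Suc j)\<close> left steps from
  \<open>j + 1\<close>. Each of the latter must be undone by a right step from \<open>j\<close>; one further right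
  step from \<open>j\<close> is needed on the way up to the target exactly if the walk is not to the right of
  \<open>j\<close>.
\<close>

definition profile_factor :: "(int \<Rightarrow> real) \<Rightarrow> int \<Rightarrow> (nat \<Rightarrow> nat) \<Rightarrow> nat \<Rightarrow> real" where
  "profile_factor \<omega> x l j = pmf (neg_binomial_pmf (l (Suc j) + of_bool (x \<le> int j)) (\<omega> (int j))) (l j)"

definition profile_prob :: "(int \<Rightarrow> real) \<Rightarrow> nat \<Rightarrow> int \<Rightarrow> (nat \<Rightarrow> nat) \<Rightarrow> real" where
  "profile_prob \<omega> n x l = (\<Prod>j<n. profile_factor \<omega> x l j)"

lemma profile_prob_nonneg: "0 \<le> profile_prob \<omega> n x l"
  by (simp add: profile_prob_def profile_factor_def prod_nonneg)

lemma profile_prob_const: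
  assumes "x \<le> 0 \<and> x' \<le> 0 \<or> int n \<le> x \<and> int n \<le> x'"
  shows "profile_prob \<omega> n x l = profile_prob \<omega> n x' l"
  unfolding profile_prob_def profile_factor_def using assms by (intro prod.cong refl) auto

lemma profile_prob_cong:
  "(\<And>j. j \<le> n \<Longrightarrow> l j = l' j) \<Longrightarrow> profile_prob \<omega> n x l = profile_prob \<omega> n x l'"
  unfolding profile_prob_def profile_factor_def by (intro prod.cong refl) auto

text \<open>
  First-step analysis at the site \<open>i\<close>. A step to the left makes the walk owe one right step from
  \<open>i - 1\<close>, but it also lowers \<open>l i\<close>, so the factor at \<open>i - 1\<close> is the same;
  all factors other than the one at \<open>i\<close> are common to the three terms, and at \<open>i\<close> the
  identity is the recursion of the negative binomial law.
\<close>

lemma profile_prob_step: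
  assumes \<omega>: "0 < \<omega> (int i)" "\<omega> (int i) < 1" and i: "i < n"
  shows "\<omega> (int i) * profile_prob \<omega> n (int i + 1) l +
      (1 - \<omega> (int i)) * (if l i > 0 then profile_prob \<omega> n (int i - 1) (l(i := l i - 1)) else 0) =
    profile_prob \<omega> n (int i) l"
proof -
  have split: "profile_prob \<omega> n x m = profile_factor \<omega> x m i * (\<Prod>j\<in>{..<n} - {i}. profile_factor \<omega> x m j)" for x m
    unfolding profile_prob_def using i by (intro prod.remove) auto
  \<comment> \<open>The factors away from \<open>i\<close> agree for a walk at \<open>i\<close>, at \<open>i + 1\<close>, and at \<open>i - 1\<close> with one left step less to make.\<close>
  have right: "(\<Prod>j\<in>{..<n} - {i}. profile_factor \<omega> (int i + 1) l j) =
      (\<Prod>j\<in>{..<n} - {i}. profile_factor \<omega> (int i) l j)"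
    by (intro prod.cong refl) (auto simp: profile_factor_def intro!: arg_cong2[where f = pmf] arg_cong2[where f = neg_binomial_pmf])
  have left: "(\<Prod>j\<in>{..<n} - {i}. profile_factor \<omega> (int i - 1) (l(i := l i - 1)) j) =
      (\<Prod>j\<in>{..<n} - {i}. profile_factor \<omega> (int i) l j)" if "l i > 0"
    using that by (intro prod.cong refl) (auto simp: profile_factor_def intro!: arg_cong2[where f = pmf] arg_cong2[where f = neg_binomial_pmf])
  have site: "\<omega> (int i) * profile_factor \<omega> (int i + 1) l i +
      (1 - \<omega> (int i)) * (if l i > 0 then profile_factor \<omega> (int i - 1) (l(i := l i - 1)) i else 0) =
    profile_factor \<omega> (int i) l i"
    using pmf_neg_binomial_step[OF \<omega>, of "l (Suc i)" "l i"] by (simp add: profile_factor_def)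
  show ?thesis
    unfolding split right site[symmetric] by (auto simp: left[unfolded One_nat_def] algebra_simps)
qed

text \<open>
  The conditional probability, given the past \<open>xs\<close>, that the left steps made before reaching
  \<open>n\<close> will add up to the profile \<open>l\<close>, or an upper bound for it if \<open>n\<close> may
  never be reached. The counts so far are subtracted from \<open>l\<close>, and a walk that has reached
  \<open>n\<close> is taken to stay there.
\<close>

definition profile_bound :: "(int \<Rightarrow> real) \<Rightarrow> nat \<Rightarrow> (nat \<Rightarrow> nat) \<Rightarrow> int list \<Rightarrow> ennreal" where
  "profile_bound \<omega> n l xs =
    (if \<exists>j<n. l j < left_count n xs (int j) then 0
     else ennreal (profile_prob \<omega> n (if int n \<in> set xs then int n else hd xs)
       (\<lambda>j. l j - left_count n xs (int j))))"

lemma profile_bound_superharmonic: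
  assumes \<omega>: "\<And>x. 0 < \<omega> x \<and> \<omega> x < 1" and l: "l n = 0"
  shows "ennreal (\<omega> x) * profile_bound \<omega> n l ((x + 1) # x # xs) +
      ennreal (1 - \<omega> x) * profile_bound \<omega> n l ((x - 1) # x # xs) \<le> profile_bound \<omega> n l (x # xs)"
proof -
  have mix: "ennreal (\<omega> x) * B + ennreal (1 - \<omega> x) * B = B" for B
    using \<omega>[of x] by (simp add: distrib_right[symmetric] ennreal_plus[symmetric] del: ennreal_plus)
  define c where "c j = left_count n (x # xs) (int j)" for j
  consider "int n \<in> set (x # xs)" | "int n \<notin> set (x # xs)" "\<not> (\<exists>i<n. x = int i)"
    | i where "int n \<notin> set (x # xs)" "i < n" "x = int i" by blast
  then show ?thesis
  proof cases
    case 1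
    then have "profile_bound \<omega> n l (y # x # xs) = profile_bound \<omega> n l (x # xs)" for y
      by (auto simp: profile_bound_def)
    then show ?thesis by (simp add: mix)
  next
    case 2
    then have out: "x < 0 \<or> int n < x"
      by (metis int_nat_eq linorder_neqE_linordered_idom list.set_intros(1) nat_less_iff not_less)
    have "profile_bound \<omega> n l (y # x # xs) = profile_bound \<omega> n l (x # xs)" if y: "y = x + 1 \<or> y = x - 1" for y
    proof -
      have "left_count n (y # x # xs) (int j) = left_count n (x # xs) (int j)" if "j < n" for j
        using out that by auto
      then have cong: "profile_prob \<omega> n x (\<lambda>j. l j - left_count n (y # x # xs) (int j)) =
          profile_prob \<omega> n x (\<lambda>j. l j - left_count n (x # xs) (int j))"
          "(\<exists>j<n. l j < left_count n (y # x # xs) (int j)) \<longleftrightarrow> (\<exists>j<n. l j < left_count n (x # xs) (int j))"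
        using l by (auto intro!: profile_prob_cong simp: le_less simp del: left_count.simps)
      have "profile_prob \<omega> n (if int n \<in> set (y # x # xs) then int n else y) m = profile_prob \<omega> n x m" for m
        using out y 2 by (intro profile_prob_const) auto
      then show ?thesis
        using 2(1) unfolding profile_bound_def by (simp only: cong if_False list.sel(1))
    qed
    then show ?thesis by (simp add: mix)
  next
    case 3
    have count_right: "left_count n ((x + 1) # x # xs) (int j) = c j" for j
      by (auto simp: c_def)
    have right: "profile_bound \<omega> n l ((x + 1) # x # xs) =
        (if \<exists>j<n. l j < c j then 0 else ennreal (profile_prob \<omega> n (int i + 1) (\<lambda>j. l j - c j)))"
      unfolding profile_bound_def count_right using 3 by auto
    have count_left: "left_count n ((x - 1) # x # xs) (int j) = c j + of_bool (j = i)" for j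
      using 3 by (auto simp: c_def)
    have left: "profile_bound \<omega> n l ((x - 1) # x # xs) =
        (if \<exists>j<n. l j < c j + of_bool (j = i) then 0
         else ennreal (profile_prob \<omega> n (int i - 1) (\<lambda>j. l j - (c j + of_bool (j = i)))))"
      unfolding profile_bound_def count_left using 3 by auto
    have here: "profile_bound \<omega> n l (x # xs) =
        (if \<exists>j<n. l j < c j then 0 else ennreal (profile_prob \<omega> n (int i) (\<lambda>j. l j - c j)))"
      unfolding profile_bound_def c_def[symmetric] using 3 by auto
    show ?thesis
    proof (cases "\<exists>j<n. l j < c j")
      case True
      then have "\<exists>j<n. l j < c j + of_bool (j = i)" by (auto intro: trans_less_add1)
      with True show ?thesis by (simp add: right left)
    next
      case False
      let ?m = "\<lambda>j. l j - c j"
      have blocked: "(\<exists>j<n. l j < c j + of_bool (j = i)) \<longleftrightarrow> ?m i = 0"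
      proof
        assume "\<exists>j<n. l j < c j + of_bool (j = i)"
        then obtain j where "j < n" "l j < c j + of_bool (j = i)" by blast
        with False show "?m i = 0" by (cases "j = i") auto
      qed (use 3(2) in \<open>auto intro!: exI[where x = i]\<close>)
      have upd: "(\<lambda>j. l j - (c j + of_bool (j = i))) = ?m(i := ?m i - 1)"
        by (auto simp: fun_eq_iff)
      have "ennreal (\<omega> x) * profile_bound \<omega> n l ((x + 1) # x # xs) +
          ennreal (1 - \<omega> x) * profile_bound \<omega> n l ((x - 1) # x # xs) =
        ennreal (\<omega> (int i) * profile_prob \<omega> n (int i + 1) ?m +
          (1 - \<omega> (int i)) * (if ?m i > 0 then profile_prob \<omega> n (int i - 1) (?m(i := ?m i - 1)) else 0))"
        unfolding right left blocked upd
        using \<omega>[of x] False by (auto simp: 3(3) ennreal_mult profile_prob_nonneg)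
      also have "\<dots> = profile_bound \<omega> n l (x # xs)"
        using \<omega> 3(2) False by (subst profile_prob_step) (auto simp: here)
      finally show ?thesis by simp
    qed
  qed
qed

text \<open>
  On a past that has reached \<open>n\<close> with profile \<open>l\<close> the functional equals 1, so its
  initial value bounds the probability of such pasts.
\<close>

lemma emeasure_left_counts_le:
  assumes \<omega>: "\<And>x. 0 < \<omega> x \<and> \<omega> x < 1" and l: "l n = 0"
  shows "emeasure (quenched_law \<omega>) {X. int n \<in> X ` {..t} \<and> (\<forall>j<n. left_steps X n (int j) = l j)}
    \<le> ennreal (profile_prob \<omega> n 0 l)"
proof -
  define A where "A = {xs. int n \<in> set xs \<and> (\<forall>j<n. left_count n xs (int j) = l j)}"
  have A: "{X. int n \<in> X ` {..t} \<and> (\<forall>j<n. left_steps X n (int j) = l j)} = past t -` A"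
  proof (intro set_eqI iffI)
    fix X assume "X \<in> past t -` A"
    then show "X \<in> {X. int n \<in> X ` {..t} \<and> (\<forall>j<n. left_steps X n (int j) = l j)}"
      using left_steps_eq_left_count[of n X t] by (simp add: A_def set_past)
  next
    fix X assume "X \<in> {X. int n \<in> X ` {..t} \<and> (\<forall>j<n. left_steps X n (int j) = l j)}"
    then show "X \<in> past t -` A"
      using left_steps_eq_left_count[of n X t] by (simp add: A_def set_past)
  qed
  have "indicator A xs \<le> profile_bound \<omega> n l xs" for xs
  proof (cases "xs \<in> A")
    case True
    have "profile_prob \<omega> n (int n) (\<lambda>j. l j - left_count n xs (int j)) = profile_prob \<omega> n (int n) (\<lambda>_. 0)"
      using True l by (intro profile_prob_cong) (auto simp: A_def le_less)
    also have "\<dots> = 1"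
      by (simp add: profile_prob_def profile_factor_def)
    finally show ?thesis
      using True by (auto simp: profile_bound_def A_def)
  qed simp
  then have "(\<integral>\<^sup>+X. indicator A (past t X) \<partial>quenched_law \<omega>) \<le> (\<integral>\<^sup>+X. profile_bound \<omega> n l (past t X) \<partial>quenched_law \<omega>)"
    by (intro nn_integral_mono)
  also have "\<dots> \<le> profile_bound \<omega> n l [0]"
    by (intro nn_integral_past_le profile_bound_superharmonic) (auto simp: \<omega> l)
  also have "\<dots> = ennreal (profile_prob \<omega> n 0 l)"
    by (auto simp: profile_bound_def)
  finally show ?thesis by (simp add: A emeasure_past)
qed

section \<open>Passage times in a fixed environment\<close>

text \<open>
  The expected time to get from \<open>j\<close> to \<open>j + 1\<close>. It satisfies
  \<open>D j = 1 / \<omega> j + \<rho> j * D (j - 1)\<close>, since in the mean \<open>1 / \<omega> j\<close>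
  steps are made from \<open>j\<close>, and the \<open>\<rho> j\<close> steps to the left among them are each
  followed by a passage from \<open>j - 1\<close> to \<open>j\<close>; iterating this gives the series.
\<close>

definition crossing_time :: "(int \<Rightarrow> real) \<Rightarrow> int \<Rightarrow> ennreal" where
  "crossing_time \<omega> j = (\<Sum>k. (1 + ennreal (odds \<omega> (j - int k))) * (\<Prod>i<k. ennreal (odds \<omega> (j - int i))))"

lemma crossing_time_rec:
  "crossing_time \<omega> j = 1 + ennreal (odds \<omega> j) + ennreal (odds \<omega> j) * crossing_time \<omega> (j - 1)"
proof -
  have shift: "j - int (Suc k) = j - 1 - int k" for k by simp
  have "crossing_time \<omega> j =
      (\<Sum>k. (1 + ennreal (odds \<omega> (j - int (Suc k)))) * (\<Prod>i<Suc k. ennreal (odds \<omega> (j - int i)))) +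
      (1 + ennreal (odds \<omega> j))"
    unfolding crossing_time_def by (subst suminf_offset[where i = 1]) simp_all
  also have "(\<lambda>k. (1 + ennreal (odds \<omega> (j - int (Suc k)))) * (\<Prod>i<Suc k. ennreal (odds \<omega> (j - int i)))) =
      (\<lambda>k. ennreal (odds \<omega> j) * ((1 + ennreal (odds \<omega> (j - 1 - int k))) * (\<Prod>i<k. ennreal (odds \<omega> (j - 1 - int i)))))"
    by (simp only: prod.lessThan_Suc_shift shift) (simp add: mult_ac)
  finally show ?thesis
    by (simp add: crossing_time_def ac_simps)
qed

text \<open>
  One more than the time elapsed plus the expected time still to go, as long as \<open>n\<close> is not reached.
  Above \<open>n\<close>, where the walk cannot be without having visited \<open>n\<close>, the value is infinite
  so that the functional is superharmonic there as well.
\<close>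

definition time_bound :: "(int \<Rightarrow> real) \<Rightarrow> nat \<Rightarrow> int list \<Rightarrow> ennreal" where
  "time_bound \<omega> n xs =
    (if int n \<in> set xs then 0 else if int n < hd xs then \<infinity>
     else of_nat (length xs) + sum (crossing_time \<omega>) {hd xs..<int n})"

lemma time_bound_superharmonic:
  assumes \<omega>: "\<And>x. 0 < \<omega> x \<and> \<omega> x < 1"
  shows "ennreal (\<omega> x) * time_bound \<omega> n ((x + 1) # x # xs) +
      ennreal (1 - \<omega> x) * time_bound \<omega> n ((x - 1) # x # xs) \<le> time_bound \<omega> n (x # xs)"
proof -
  consider "int n \<in> set (x # xs)" | "int n \<notin> set (x # xs)" "int n < x" | "int n \<notin> set (x # xs)" "x < int n"
    by force
  then show ?thesis
  proof cases
    case 3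
    let ?p = "ennreal (\<omega> x)" and ?q = "ennreal (1 - \<omega> x)"
    let ?D = "crossing_time \<omega>" and ?L = "of_nat (length (x # xs)) :: ennreal"
    let ?S = "sum (crossing_time \<omega>) {x + 1..<int n}"
    have W: "sum ?D {x..<int n} = ?D x + ?S" "sum ?D {x - 1..<int n} = ?D (x - 1) + (?D x + ?S)"
    proof -
      have "{x..<int n} = insert x {x + 1..<int n}" "{x - 1..<int n} = insert (x - 1) (insert x {x + 1..<int n})"
        using 3 by auto
      then show "sum ?D {x..<int n} = ?D x + ?S" "sum ?D {x - 1..<int n} = ?D (x - 1) + (?D x + ?S)"
        by simp_all
    qed
    have odds: "0 \<le> odds \<omega> x" "\<omega> x * odds \<omega> x = 1 - \<omega> x"
      using \<omega>[of x] by (simp_all add: odds_def)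
    have pq: "?p + ?q = 1"
      using \<omega>[of x] by (simp add: ennreal_plus[symmetric] del: ennreal_plus)
    have po: "?p * ennreal (odds \<omega> x) = ?q"
      using \<omega>[of x] odds by (simp add: ennreal_mult[symmetric])
    \<comment> \<open>The recursion for \<open>D\<close>, multiplied by \<open>\<omega> x\<close>; it is what makes the two sides below equal.\<close>
    have pD: "?p * ?D x = 1 + ?q * ?D (x - 1)"
    proof -
      have "?p * ?D x = ?p + ?p * ennreal (odds \<omega> x) + (?p * ennreal (odds \<omega> x)) * ?D (x - 1)"
        by (subst crossing_time_rec) (simp add: algebra_simps)
      then show ?thesis by (simp add: po pq)
    qed
    have right: "time_bound \<omega> n ((x + 1) # x # xs) \<le> ?L + 1 + ?S"
      using 3 by (auto simp: time_bound_def)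
    have left: "time_bound \<omega> n ((x - 1) # x # xs) \<le> ?L + 1 + (?D (x - 1) + (?D x + ?S))"
      using 3 by (auto simp: time_bound_def W)
    have "?p * time_bound \<omega> n ((x + 1) # x # xs) + ?q * time_bound \<omega> n ((x - 1) # x # xs) \<le>
        ?p * (?L + 1 + ?S) + ?q * (?L + 1 + (?D (x - 1) + (?D x + ?S)))"
      by (intro add_mono mult_left_mono right left) auto
    also have "\<dots> = (?p + ?q) * (?L + ?S) + ((?p + ?q) + ?q * ?D (x - 1)) + ?q * ?D x"
      by (simp add: algebra_simps)
    also have "\<dots> = ?L + ?S + (?p + ?q) * ?D x"
      by (simp only: distrib_right[of ?p ?q "?D x"] pD) (simp add: pq ac_simps)
    also have "\<dots> = time_bound \<omega> n (x # xs)"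
      using 3 by (simp add: time_bound_def W pq ac_simps)
    finally show ?thesis .
  qed (auto simp: time_bound_def)
qed

lemma emeasure_not_reached_le:
  assumes \<omega>: "\<And>x. 0 < \<omega> x \<and> \<omega> x < 1"
  shows "of_nat (Suc t) * emeasure (quenched_law \<omega>) {X. int n \<notin> X ` {..t}} \<le>
    1 + sum (crossing_time \<omega>) {0..<int n}"
proof -
  define A where "A = {xs. length xs = Suc t \<and> int n \<notin> set xs}"
  have A: "{X. int n \<notin> X ` {..t}} = past t -` A"
    by (auto simp: A_def set_past)
  have "of_nat (Suc t) * indicator A xs \<le> time_bound \<omega> n xs" for xs
  proof (cases "xs \<in> A")
    case True
    then show ?thesis
      by (auto simp: A_def time_bound_def intro!: add_increasing2)
  qed simp
  then have "of_nat (Suc t) * (\<integral>\<^sup>+X. indicator A (past t X) \<partial>quenched_law \<omega>) \<le>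
      (\<integral>\<^sup>+X. time_bound \<omega> n (past t X) \<partial>quenched_law \<omega>)"
    by (subst nn_integral_cmult[symmetric])
      (auto intro!: nn_integral_mono measurable_compose[OF measurable_quenched_past])
  also have "\<dots> \<le> time_bound \<omega> n [0]"
    by (intro nn_integral_past_le time_bound_superharmonic \<omega>)
  also have "\<dots> \<le> 1 + sum (crossing_time \<omega>) {0..<int n}"
    by (simp add: time_bound_def)
  finally show ?thesis by (simp add: A emeasure_past)
qed

section \<open>Averaging over the environment\<close>

lemma past_event: "past t -` A \<in> sets path_space"
  using measurable_sets[OF measurable_past, of A t] by (simp add: space_PiM)

lemma not_reached_event: "{X. int n \<notin> X ` {..t}} \<in> sets path_space"
proof -
  have "{X. int n \<notin> X ` {..t}} = past t -` {xs. int n \<notin> set xs}"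
    by (auto simp: set_past)
  then show ?thesis by (simp only: past_event)
qed

lemma left_steps_event:
  "{X. int n \<in> X ` {..t} \<and> (\<forall>j<n. left_steps X n (int j) = l j)} \<in> sets path_space"
proof -
  have "{X. int n \<in> X ` {..t} \<and> (\<forall>j<n. left_steps X n (int j) = l j)} =
      past t -` {xs. int n \<in> set xs \<and> (\<forall>j<n. left_count n xs (int j) = l j)}"
    using left_steps_eq_left_count[of n _ t] by (auto simp add: set_past simp del: imageE)
  then show ?thesis by (simp only: past_event)
qed

context site_law begin

lemma space_env_law: "\<omega> \<in> space (env_law \<mu>) \<longleftrightarrow> (\<forall>x. 0 < \<omega> x \<and> \<omega> x < 1)"
  by (auto simp: env_law_def space_PiM PiE_iff space_site)

lemma measurable_env_law: "f \<in> measurable \<mu> N \<Longrightarrow> (\<lambda>\<omega>. f (\<omega> i)) \<in> measurable (env_law \<mu>) N"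
  unfolding env_law_def
  by (rule measurable_compose[OF measurable_component_singleton]) auto

lemma sets_annealed_law: "sets (annealed_law \<mu>) = sets path_space"
  unfolding annealed_law_def
  by (rule sets_bind'[OF env_law_props[OF prob_space_axioms sets_site] measurable_quenched_law])

lemma emeasure_annealed_mono:
  assumes "A \<in> sets path_space"
    and "\<And>\<omega>. (\<And>x. 0 < \<omega> x \<and> \<omega> x < 1) \<Longrightarrow> emeasure (quenched_law \<omega>) A \<le> B \<omega>"
  shows "emeasure (annealed_law \<mu>) A \<le> (\<integral>\<^sup>+\<omega>. B \<omega> \<partial>env_law \<mu>)"
  unfolding emeasure_annealed_law[OF prob_space_axioms sets_site assms(1)]
  using assms(2) by (intro nn_integral_mono) (auto simp: space_env_law)

definition mean_odds :: ennreal where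
  "mean_odds = (\<integral>\<^sup>+a. ennreal ((1 - a) / a) \<partial>\<mu>)"

lemma measurable_odds: "(\<lambda>a. ennreal ((1 - a) / a)) \<in> borel_measurable \<mu>"
  by (rule measurable_compose[OF measurable_site]) auto

lemma measurable_odds_env [measurable]: "(\<lambda>\<omega>. ennreal (odds \<omega> i)) \<in> borel_measurable (env_law \<mu>)"
  unfolding odds_def by (rule measurable_env_law[OF measurable_odds])

text \<open>
  The sites occurring in one term of the series are distinct, so independence turns the series into a geometric
  one.
\<close>

lemma nn_integral_crossing_time:
  "(\<integral>\<^sup>+\<omega>. crossing_time \<omega> j \<partial>env_law \<mu>) = (1 + mean_odds) * (\<Sum>k. mean_odds ^ k)"
proof -
  have "(\<integral>\<^sup>+\<omega>. crossing_time \<omega> j \<partial>env_law \<mu>) =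
      (\<Sum>k. \<integral>\<^sup>+\<omega>. (1 + ennreal (odds \<omega> (j - int k))) * (\<Prod>i<k. ennreal (odds \<omega> (j - int i))) \<partial>env_law \<mu>)"
    unfolding crossing_time_def by (rule nn_integral_suminf) measurable
  also have "\<dots> = (\<Sum>k. (1 + mean_odds) * mean_odds ^ k)"
  proof (rule suminf_cong)
    fix k
    let ?J = "(\<lambda>i. j - int i) ` {..<Suc k}"
    let ?f = "\<lambda>x a. if x = j - int k then 1 + ennreal ((1 - a) / a) else ennreal ((1 - a) / a)"
    have inj: "inj_on (\<lambda>i. j - int i) {..<Suc k}" by (auto simp: inj_on_def)
    have prod_eq: "(\<Prod>x\<in>?J. g x) = g (j - int k) * (\<Prod>i<k. g (j - int i))" for g :: "int \<Rightarrow> ennreal"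
      by (simp add: prod.reindex[OF inj] mult.commute)
    have "(\<integral>\<^sup>+\<omega>. (1 + ennreal (odds \<omega> (j - int k))) * (\<Prod>i<k. ennreal (odds \<omega> (j - int i))) \<partial>env_law \<mu>) =
        (\<integral>\<^sup>+\<omega>. (\<Prod>x\<in>?J. ?f x (\<omega> x)) \<partial>env_law \<mu>)"
      unfolding prod_eq odds_def by (intro nn_integral_cong) simp
    also have "\<dots> = (\<Prod>x\<in>?J. \<integral>\<^sup>+a. ?f x a \<partial>\<mu>)"
      using measurable_odds by (intro nn_integral_env_law_prod) auto
    also have "\<dots> = (1 + mean_odds) * mean_odds ^ k"
      unfolding prod_eq
      by (simp add: mean_odds_def nn_integral_add measurable_odds emeasure_space_1)
    finally show "(\<integral>\<^sup>+\<omega>. (1 + ennreal (odds \<omega> (j - int k))) * (\<Prod>i<k. ennreal (odds \<omega> (j - int i))) \<partial>env_law \<mu>) = \<dots>" .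
  qed
  finally show ?thesis by simp
qed

lemma crossing_time_finite:
  assumes "mean_odds < 1"
  shows "(\<integral>\<^sup>+\<omega>. crossing_time \<omega> j \<partial>env_law \<mu>) < \<infinity>"
proof -
  obtain r where r: "mean_odds = ennreal r" "0 \<le> r"
    using assms by (cases mean_odds) auto
  with assms have "r < 1" by simp
  with r have "(\<Sum>k. mean_odds ^ k) = ennreal (1 / (1 - r))"
    unfolding r(1) ennreal_power[OF r(2)] by (intro suminf_ennreal_eq geometric_sums) auto
  then show ?thesis
    unfolding nn_integral_crossing_time by (simp add: r(1) ennreal_mult_less_top)
qed

lemma never_reached_event: "{X. \<forall>t. X t \<noteq> int n} \<in> sets path_space"
proof -
  have "{X :: nat \<Rightarrow> int. \<forall>t. X t \<noteq> int n} = (\<Inter>t. {X. int n \<notin> X ` {..t}})"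
  proof (intro set_eqI iffI)
    fix X :: "nat \<Rightarrow> int" assume "X \<in> (\<Inter>t. {X. int n \<notin> X ` {..t}})"
    then have "\<not> (\<exists>r\<le>t. X r = int n)" for t by (simp add: reached_iff)
    then show "X \<in> {X. \<forall>t. X t \<noteq> int n}" by blast
  qed (auto simp: reached_iff)
  moreover have "(\<Inter>t. {X. int n \<notin> X ` {..t}}) \<in> sets path_space"
    using not_reached_event by (intro sets.countable_INT) auto
  ultimately show ?thesis by simp
qed

text \<open>
  Ballisticity gives the passage time to \<open>n\<close> a finite annealed mean. Hence the probability of not
  having reached \<open>n\<close> by time \<open>t\<close> is \<open>O(1/t)\<close>.
\<close>

lemma emeasure_never_reached:
  assumes "mean_odds < 1"
  shows "emeasure (annealed_law \<mu>) {X. \<forall>t. X t \<noteq> int n} = 0"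
proof -
  define N :: "(nat \<Rightarrow> int) set" where "N = {X. \<forall>t. X t \<noteq> int n}"
  have N: "N \<in> sets path_space"
    unfolding N_def by (rule never_reached_event)
  define C where "C = (\<integral>\<^sup>+\<omega>. 1 + sum (crossing_time \<omega>) {0..<int n} \<partial>env_law \<mu>)"
  have meas: "(\<lambda>\<omega>. crossing_time \<omega> j) \<in> borel_measurable (env_law \<mu>)" for j
    unfolding crossing_time_def by measurable
  have prob_env: "emeasure (env_law \<mu>) (space (env_law \<mu>)) = 1"
    unfolding env_law_def by (intro prob_space.emeasure_space_1 prob_space_PiM prob_space_axioms)
  have "C = 1 + (\<Sum>j\<in>{0..<int n}. \<integral>\<^sup>+\<omega>. crossing_time \<omega> j \<partial>env_law \<mu>)"
    unfolding C_def by (subst nn_integral_add) (simp_all add: nn_integral_sum meas borel_measurable_sum prob_env)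
  then have C: "C < \<infinity>"
    using crossing_time_finite[OF assms] by simp
  have le: "of_nat (Suc t) * emeasure (annealed_law \<mu>) N \<le> C" for t
  proof -
    have "emeasure (quenched_law \<omega>) N \<le> emeasure (quenched_law \<omega>) {X. int n \<notin> X ` {..t}}" for \<omega>
      using not_reached_event by (intro emeasure_mono) (auto simp: N_def)
    then have "of_nat (Suc t) * emeasure (quenched_law \<omega>) N \<le> 1 + sum (crossing_time \<omega>) {0..<int n}"
      if "\<And>x. 0 < \<omega> x \<and> \<omega> x < 1" for \<omega>
      using emeasure_not_reached_le[OF that, where t = t and n = n] by (meson mult_left_mono order_trans zero_le)
    moreover have "(\<lambda>\<omega>. emeasure (quenched_law \<omega>) N) \<in> borel_measurable (env_law \<mu>)"
    proof -
      have env: "sets (env_law \<mu>) = sets (PiM UNIV (\<lambda>_. unit_borel))"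
        using env_law_props[OF prob_space_axioms sets_site] by (simp add: space_prob_algebra)
      show ?thesis
        by (subst measurable_cong_sets[OF env refl])
          (rule measurable_emeasure_kernel[OF measurable_prob_algebraD[OF measurable_quenched_law] N])
    qed
    ultimately show ?thesis
      unfolding C_def emeasure_annealed_law[OF prob_space_axioms sets_site N]
      by (subst nn_integral_cmult[symmetric]) (auto simp: space_env_law simp del: of_nat_Suc intro!: nn_integral_mono)
  qed
  interpret A: prob_space "annealed_law \<mu>"
    by (rule prob_space_annealed_law[OF prob_space_axioms sets_site])
  obtain c where c: "C = ennreal c" "0 \<le> c"
    using C by (cases C) auto
  have "real (Suc t) * A.prob N \<le> c" for t
  proof -
    have "ennreal (real (Suc t) * A.prob N) \<le> ennreal c"
      using le[of t] by (simp add: A.emeasure_eq_measure c ennreal_of_nat_eq_real_of_nat ennreal_mult del: of_nat_Suc)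
    then show ?thesis using c(2) by (simp del: of_nat_Suc)
  qed
  then have "\<not> 0 < A.prob N"
    using reals_Archimedean3[of "A.prob N"] by (metis lessI less_le_trans mult_le_cancel_right not_le of_nat_less_iff order_less_imp_le)
  then have "A.prob N = 0"
    using measure_nonneg[of "annealed_law \<mu>" N] by linarith
  then show ?thesis
    by (simp add: A.emeasure_eq_measure N_def)
qed

end

section \<open>The Markov chain of left-step counts\<close>

definition last_state :: "nat list \<Rightarrow> nat" where
  "last_state l = (case l of [] \<Rightarrow> 0 | y # _ \<Rightarrow> y)"

text \<open>
  The chain starts at \<open>0\<close>, the number of left steps from the target \<open>n\<close>, and moves to
  the number of left steps from \<open>n - 1\<close>, then from \<open>n - 2\<close>, and so on. Its trajectory is
  kept most recent state first and without the initial \<open>0\<close>, so that after \<open>n\<close> steps the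
  list reads off the counts at the sites \<open>0, \<dots>, n - 1\<close> in this order.
\<close>

primrec chain_pmf :: "real measure \<Rightarrow> nat \<Rightarrow> nat list pmf" where
  "chain_pmf \<mu> 0 = return_pmf []"
| "chain_pmf \<mu> (Suc n) = bind_pmf (chain_pmf \<mu> n) (\<lambda>l. map_pmf (\<lambda>y. y # l) (step_pmf \<mu> (last_state l)))"

definition left_profile :: "nat \<Rightarrow> (nat \<Rightarrow> int) \<Rightarrow> nat list" where
  "left_profile n X = map (\<lambda>j. left_steps X n (int j)) [0..<n]"

lemma last_state_simps [simp]: "last_state [] = 0" "last_state (y # l) = y"
  by (simp_all add: last_state_def)

text \<open>
  Beyond the end of the list lies the initial state \<open>0\<close>.
\<close>

definition entry :: "nat list \<Rightarrow> nat \<Rightarrow> nat" where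
  "entry l j = (if j < length l then l ! j else 0)"

lemma entry_Cons: "entry (y # l) 0 = y" "entry (y # l) (Suc j) = entry l j" "entry l 0 = last_state l"
  by (cases l; simp add: entry_def)+

context site_law begin

lemma pmf_chain_pmf:
  "pmf (chain_pmf \<mu> (length l)) l = (\<Prod>j<length l. step_prob \<mu> (entry l (Suc j)) (entry l j))"
proof (induction l)
  case (Cons y l)
  have "pmf (chain_pmf \<mu> (length (y # l))) (y # l) =
      pmf (chain_pmf \<mu> (length l)) l * step_prob \<mu> (last_state l) y"
    by (simp add: pmf_bind_Cons pmf_step_pmf)
  with Cons show ?case
    by (simp only: length_Cons prod.lessThan_Suc_shift entry_Cons) (simp add: mult.commute)
qed simp

text \<open>
  The quenched bound is a product with one factor per site; independence lets each be averaged separately.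
\<close>

lemma emeasure_left_profile_le:
  "emeasure (annealed_law \<mu>) {X. int n \<in> X ` {..t} \<and> (\<forall>j<n. left_steps X n (int j) = l j)} \<le>
    ennreal (\<Prod>j<n. step_prob \<mu> (l (Suc j)) (l j))" if "l n = 0"
proof -
  have "emeasure (annealed_law \<mu>) {X. int n \<in> X ` {..t} \<and> (\<forall>j<n. left_steps X n (int j) = l j)} \<le>
      (\<integral>\<^sup>+\<omega>. ennreal (profile_prob \<omega> n 0 l) \<partial>env_law \<mu>)"
    by (rule emeasure_annealed_mono[OF left_steps_event emeasure_left_counts_le]) (auto simp: that)
  also have "\<dots> = (\<integral>\<^sup>+\<omega>. (\<Prod>x\<in>int ` {..<n}. ennreal (pmf (neg_binomial_pmf (Suc (l (Suc (nat x)))) (\<omega> x)) (l (nat x)))) \<partial>env_law \<mu>)"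
    by (intro nn_integral_cong)
      (simp add: profile_prob_def profile_factor_def prod_ennreal prod.reindex inj_on_def)
  also have "\<dots> = (\<Prod>x\<in>int ` {..<n}. ennreal (step_prob \<mu> (l (Suc (nat x))) (l (nat x))))"
    unfolding nn_step_prob
    by (rule nn_integral_env_law_prod) (auto intro: measurable_compose[OF measurable_neg_binomial])
  also have "\<dots> = ennreal (\<Prod>j<n. step_prob \<mu> (l (Suc j)) (l j))"
    by (simp add: prod.reindex prod_ennreal less_imp_le[OF step_prob_pos])
  finally show ?thesis .
qed

text \<open>
  Events are transferred from the walk to the chain by summing the bound for single profiles over the countable
  set of all profiles in \<open>S\<close>.
\<close>

lemma emeasure_left_profile_chain:
  shows "{X. (\<exists>t. X t = int n) \<and> left_profile n X \<in> S} \<in> sets path_space" (is ?meas)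
    and "emeasure (annealed_law \<mu>) {X. (\<exists>t. X t = int n) \<and> left_profile n X \<in> S} \<le> emeasure (chain_pmf \<mu> n) S" (is ?le)
proof -
  let ?S = "{l \<in> S. length l = n}"
  let ?E = "\<lambda>l t. {X. int n \<in> X ` {..t} \<and> (\<forall>j<n. left_steps X n (int j) = entry l j)}"
  let ?F = "\<lambda>l. \<Union>t. ?E l t"
  have F: "?F l = {X. (\<exists>t. X t = int n) \<and> left_profile n X = l}" if "length l = n" for l
    using that by (auto simp: reached_iff left_profile_def entry_def list_eq_iff_nth_eq)
  have sets_F: "?F l \<in> sets path_space" for l
    by (intro sets.countable_UN image_subsetI left_steps_event)
  have eq: "{X. (\<exists>t. X t = int n) \<and> left_profile n X \<in> S} = (\<Union>l\<in>?S. ?F l)"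
  proof -
    have "(\<Union>l\<in>?S. ?F l) = (\<Union>l\<in>?S. {X. (\<exists>t. X t = int n) \<and> left_profile n X = l})"
      by (intro SUP_cong refl) (simp add: F)
    then show ?thesis by (auto simp: left_profile_def)
  qed
  show ?meas
    unfolding eq by (rule sets.countable_UN''[OF countableI_type sets_F])
  have le: "emeasure (annealed_law \<mu>) (?F l) \<le> ennreal (pmf (chain_pmf \<mu> n) l)" if "l \<in> ?S" for l
  proof -
    have "emeasure (annealed_law \<mu>) (?F l) = (SUP t. emeasure (annealed_law \<mu>) (?E l t))"
      by (intro SUP_emeasure_incseq[symmetric])
        (use left_steps_event in \<open>auto simp: sets_annealed_law incseq_def reached_iff intro: order_trans\<close>)
    also have "\<dots> \<le> ennreal (pmf (chain_pmf \<mu> n) l)"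
    proof (rule SUP_least)
      fix t
      have "entry l n = 0" and len: "length l = n" using that by (auto simp: entry_def)
      from emeasure_left_profile_le[where l = "entry l" and t = t, OF this(1)] pmf_chain_pmf[of l]
      show "emeasure (annealed_law \<mu>) (?E l t) \<le> ennreal (pmf (chain_pmf \<mu> n) l)"
        unfolding len by simp
    qed
    finally show ?thesis .
  qed
  have "emeasure (annealed_law \<mu>) (\<Union>l\<in>?S. ?F l) = (\<integral>\<^sup>+l. emeasure (annealed_law \<mu>) (?F l) \<partial>count_space ?S)"
  proof (rule emeasure_UN_countable)
    show "?F l \<in> sets (annealed_law \<mu>)" for l
      by (simp only: sets_annealed_law sets_F)
    show "disjoint_family_on ?F ?S"
      unfolding disjoint_family_on_def
    proof (intro ballI impI)
      fix k l assume "k \<in> ?S" "l \<in> ?S" "k \<noteq> l"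
      then have "length k = n" "length l = n" by auto
      from F[OF this(1)] F[OF this(2)] \<open>k \<noteq> l\<close> show "?F k \<inter> ?F l = {}" by auto
    qed
  qed simp
  also have "\<dots> \<le> (\<integral>\<^sup>+l. pmf (chain_pmf \<mu> n) l \<partial>count_space ?S)"
    using le by (intro nn_integral_mono) simp
  also have "\<dots> = emeasure (chain_pmf \<mu> n) ?S"
    by (rule nn_integral_pmf)
  also have "\<dots> \<le> emeasure (chain_pmf \<mu> n) S"
    by (rule emeasure_mono) auto
  finally show ?le unfolding eq .
qed

end

section \<open>Identification of the site law\<close>

text \<open>
  The numbers \<open>step_prob \<mu> x y\<close> with \<open>x\<close> fixed are, up to binomial coefficients, the
  moments of \<open>1 - a\<close> under the measure with density \<open>a ^ (x + 1)\<close>. By Bernstein's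
  theorem they determine the integrals of all continuous functions against this measure. The density vanishes only
  at the endpoint 0, so that a function supported away from 0 can be divided by it, and this gives the tails of
  \<open>\<mu>\<close>.
\<close>

lemma moments_determine_site_law:
  assumes \<mu>: "site_law \<mu>" and \<mu>': "site_law \<mu>'"
    and eq: "\<And>y. step_prob \<mu> x y = step_prob \<mu>' x y"
  shows "\<mu> = \<mu>'"
proof -
  interpret A: site_law \<mu> by (rule \<mu>)
  interpret B: site_law \<mu>' by (rule \<mu>')
  \<comment> \<open>Raising the power of \<open>a\<close> is possible because \<open>a = 1 - (1 - a)\<close>.\<close>
  have mom: "(\<integral>a. a ^ (x + 1 + k) * (1 - a) ^ y \<partial>\<mu>) = (\<integral>a. a ^ (x + 1 + k) * (1 - a) ^ y \<partial>\<mu>')" for k y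
  proof (induction k arbitrary: y)
    case 0
    then show ?case
      using eq[of y] by (simp add: A.step_prob_eq B.step_prob_eq)
  next
    case (Suc k)
    have "a ^ (x + 1 + Suc k) * (1 - a) ^ y =
        a ^ (x + 1 + k) * (1 - a) ^ y - a ^ (x + 1 + k) * (1 - a) ^ Suc y" for a :: real
      by (simp add: algebra_simps)
    then show ?case
      by (simp only: Bochner_Integration.integral_diff A.integrable_moment B.integrable_moment Suc)
  qed
  have cont: "(\<integral>a. a ^ (x + 1) * f a \<partial>\<mu>) = (\<integral>a. a ^ (x + 1) * f a \<partial>\<mu>')"
    if f: "continuous_on UNIV f" for f :: "real \<Rightarrow> real"
  proof -
    have approx: "\<bar>(\<integral>a. a ^ (x + 1) * f a \<partial>\<mu>) - (\<integral>a. a ^ (x + 1) * f a \<partial>\<mu>')\<bar> \<le> 2 * e" if e: "e > 0" for e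
    proof -
      from Bernstein_Weierstrass[OF continuous_on_subset[OF f subset_UNIV] e]
      obtain n where n: "\<And>a. 0 \<le> a \<Longrightarrow> a \<le> 1 \<Longrightarrow> \<bar>f a - (\<Sum>k\<le>n. f (k / n) * Bernstein n k a)\<bar> < e"
        by fastforce
      define p where "p a = (\<Sum>k\<le>n. f (k / n) * Bernstein n k a)" for a
      have p_eq: "a ^ (x + 1) * p a = (\<Sum>k\<le>n. f (k / n) * (n choose k) * (a ^ (x + 1 + k) * (1 - a) ^ (n - k)))" for a
        by (simp add: p_def Bernstein_def sum_distrib_left power_add mult_ac)
      have p_int: "(\<integral>a. a ^ (x + 1) * p a \<partial>\<mu>) = (\<integral>a. a ^ (x + 1) * p a \<partial>\<mu>')"
        unfolding p_eq
        by (simp only: Bochner_Integration.integral_sum integrable_mult_right A.integrable_moment B.integrable_moment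
            integral_mult_right_zero mom)
      have close: "\<bar>(\<integral>a. a ^ (x + 1) * f a \<partial>M) - (\<integral>a. a ^ (x + 1) * p a \<partial>M)\<bar> \<le> e" if "site_law M" for M
      proof -
        interpret M: site_law M by (rule that)
        have fm: "(\<lambda>a. a ^ (x + 1) * f a) \<in> borel_measurable borel" "(\<lambda>a. a ^ (x + 1) * p a) \<in> borel_measurable borel"
          using borel_measurable_continuous_onI[OF f] by (auto simp: p_def Bernstein_def)
        obtain K where K: "\<And>a. a \<in> {0..1} \<Longrightarrow> \<bar>f a\<bar> \<le> K"
          using compact_imp_bounded[OF compact_continuous_image[OF continuous_on_subset[OF f subset_UNIV] compact_Icc[of 0 1]]]
          by (auto simp: bounded_iff) (metis atLeastAtMost_iff)
        have pK: "\<bar>p a\<bar> \<le> K + e" if "a \<in> {0..1}" for a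
          using K[OF that] n[of a] that unfolding p_def[symmetric] by auto
        have b: "\<bar>a ^ (x + 1) * u\<bar> \<le> v" if "0 < a" "a < 1" "\<bar>u\<bar> \<le> v" for a u v :: real
        proof -
          have "a ^ (x + 1) \<le> 1" using that by (intro power_le_one) auto
          then have "\<bar>a ^ (x + 1)\<bar> * \<bar>u\<bar> \<le> 1 * v" using that by (intro mult_mono) auto
          then show ?thesis by (simp only: abs_mult mult_1)
        qed
        have fi: "integrable M (\<lambda>a. a ^ (x + 1) * f a)"
          by (rule M.integrable_site[OF fm(1), of K]) (intro b K, auto)
        have pi: "integrable M (\<lambda>a. a ^ (x + 1) * p a)"
          by (rule M.integrable_site[OF fm(2), of "K + e"]) (intro b pK, auto)
        have "\<bar>(\<integral>a. a ^ (x + 1) * f a - a ^ (x + 1) * p a \<partial>M)\<bar> \<le> (\<integral>a. \<bar>a ^ (x + 1) * f a - a ^ (x + 1) * p a\<bar> \<partial>M)"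
          by (rule integral_abs_bound)
        also have "\<dots> \<le> (\<integral>a. e \<partial>M)"
        proof (rule integral_mono)
          show "integrable M (\<lambda>a. \<bar>a ^ (x + 1) * f a - a ^ (x + 1) * p a\<bar>)"
            using fi pi by (intro integrable_abs Bochner_Integration.integrable_diff)
          show "\<bar>a ^ (x + 1) * f a - a ^ (x + 1) * p a\<bar> \<le> e" if "a \<in> space M" for a
            using b[of a "f a - p a" e] n[of a] that unfolding p_def[symmetric] right_diff_distrib[symmetric]
            by (auto simp: M.space_site)
        qed simp
        also have "\<dots> = e" by (simp add: M.prob_space)
        finally show ?thesis
          by (simp only: Bochner_Integration.integral_diff[OF fi pi])
      qed
      show ?thesis
        using close[OF \<mu>] close[OF \<mu>'] p_int by linarith
    qed
    show ?thesis
      using approx[of "\<bar>(\<integral>a. a ^ (x + 1) * f a \<partial>\<mu>) - (\<integral>a. a ^ (x + 1) * f a \<partial>\<mu>')\<bar> / 4"] by (auto simp: field_simps)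
  qed
  have tail: "measure \<mu> ({c<..} \<inter> space \<mu>) = measure \<mu>' ({c<..} \<inter> space \<mu>')" if "0 < c" for c
  proof -
    let ?f = "\<lambda>m a. min 1 (real m * max 0 (a - c))"
    have lim: "(\<lambda>m. (\<integral>a. ?f m a \<partial>M)) \<longlonglongrightarrow> measure M ({c<..} \<inter> space M)" if "site_law M" for M
    proof -
      interpret M: site_law M by (rule that)
      have "(\<lambda>m. (\<integral>a. ?f m a \<partial>M)) \<longlonglongrightarrow> (\<integral>a. indicator {c<..} a \<partial>M)"
      proof (rule integral_dominated_convergence[where w = "\<lambda>_. 1"])
        show "AE a in M. (\<lambda>m. ?f m a) \<longlonglongrightarrow> indicator {c<..} a"
        proof (rule AE_I2)
          fix a
          show "(\<lambda>m. ?f m a) \<longlonglongrightarrow> indicator {c<..} a"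
          proof (cases "c < a")
            case True
            then obtain N where "1 / (a - c) < real N" using reals_Archimedean2 by blast
            have "1 \<le> real m * (a - c)" if "N \<le> m" for m
            proof -
              have "1 = 1 / (a - c) * (a - c)" using True by simp
              also have "\<dots> \<le> real m * (a - c)"
                using True \<open>1 / (a - c) < real N\<close> that by (intro mult_right_mono) auto
              finally show ?thesis .
            qed
            with True have "eventually (\<lambda>m. ?f m a = 1) sequentially"
              by (intro eventually_sequentiallyI[of N]) (auto simp: min_def max_def)
            with True show ?thesis
              by (simp add: tendsto_eventually)
          qed simp
        qed
      qed (auto intro!: M.measurable_site)
      then show ?thesis by (simp add: M.sets_site)
    qed
    have "(\<integral>a. ?f m a \<partial>\<mu>) = (\<integral>a. ?f m a \<partial>\<mu>')" for m
    proof -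
      \<comment> \<open>The maximum keeps the quotient continuous near 0 and changes nothing where the numerator is not 0.\<close>
      let ?g = "\<lambda>a. ?f m a / (max c a) ^ (x + 1)"
      have "a ^ (x + 1) * ?g a = ?f m a" if "0 < a" for a
        using that \<open>0 < c\<close> by (cases "c < a") (auto simp: max_def)
      then have damped: "(\<integral>a. a ^ (x + 1) * ?g a \<partial>M) = (\<integral>a. ?f m a \<partial>M)" if "site_law M" for M
        using site_law.space_site[OF that] by (intro Bochner_Integration.integral_cong refl) simp
      have "continuous_on UNIV ?g"
        using \<open>0 < c\<close> by (intro continuous_intros) (auto simp: max_def)
      from cont[OF this] show ?thesis
        unfolding damped[OF \<mu>] damped[OF \<mu>'] .
    qed
    then show ?thesis
      using LIMSEQ_unique[OF lim[OF \<mu>]] lim[OF \<mu>'] by simp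
  qed
  have borel: "distr \<mu> borel (\<lambda>a. a) = distr \<mu>' borel (\<lambda>a. a)"
  proof -
    have meas: "(\<lambda>a. a) \<in> measurable N borel" if "site_law N" for N
      by (rule site_law.measurable_site[OF that]) simp
    have rd: "real_distribution (distr N borel (\<lambda>a. a))" if "site_law N" for N
    proof -
      interpret N: site_law N by (rule that)
      show ?thesis by (intro N.real_distribution_distr meas that)
    qed
    have "cdf (distr N borel (\<lambda>a. a)) c = (if c \<le> 0 then 0 else 1 - measure N ({c<..} \<inter> space N))" if "site_law N" for N c
    proof -
      interpret N: site_law N by (rule that)
      have "cdf (distr N borel (\<lambda>a. a)) c = measure N ({..c} \<inter> space N)"
        unfolding cdf_def by (subst measure_distr[OF meas[OF that]]) auto
      also have "{..c} \<inter> space N = space N - ({c<..} \<inter> space N)" by auto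
      also have "measure N \<dots> = 1 - measure N ({c<..} \<inter> space N)"
        using measurable_sets[OF meas[OF that], of "{c<..}"] by (intro N.prob_compl) simp
      also have "\<dots> = (if c \<le> 0 then 0 else 1 - measure N ({c<..} \<inter> space N))"
      proof (cases "c \<le> 0")
        case True
        then have "{c<..} \<inter> space N = space N" by (auto simp: N.space_site)
        with True show ?thesis by (simp add: N.prob_space)
      qed simp
      finally show ?thesis .
    qed
    then have "cdf (distr \<mu> borel (\<lambda>a. a)) c = cdf (distr \<mu>' borel (\<lambda>a. a)) c" for c
      using tail[of c] \<mu> \<mu>' by simp
    then show ?thesis
      using rd \<mu> \<mu>' by (intro cdf_unique) auto
  qed
  show ?thesis
  proof (rule measure_eqI)
    show "sets \<mu> = sets \<mu>'" by (simp only: A.sets_site B.sets_site)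
    fix S assume "S \<in> sets \<mu>"
    then have S: "S \<in> sets borel" "S \<subseteq> {0<..<1}"
      by (auto simp: A.sets_site sets_restrict_space)
    have "emeasure N S = emeasure (distr N borel (\<lambda>a. a)) S" if "site_law N" for N
    proof -
      interpret N: site_law N by (rule that)
      have "(\<lambda>a. a) -` S \<inter> space N = S" using S(2) by (auto simp: N.space_site)
      then show ?thesis
        using S(1) by (subst emeasure_distr) (auto intro: N.measurable_site)
    qed
    then show "emeasure \<mu> S = emeasure \<mu>' S"
      using borel \<mu> \<mu>' by simp
  qed
qed

section \<open>Affinities uniform near a parameter\<close>

lemma weighted_AM_GM_cube:
  fixes s u :: real
  assumes "0 \<le> s" "0 \<le> u"
  shows "s\<^sup>2 * u \<le> (2 * s ^ 3 + u ^ 3) / 3"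
    and "s \<noteq> u \<Longrightarrow> s\<^sup>2 * u < (2 * s ^ 3 + u ^ 3) / 3"
proof -
  have eq: "2 * s ^ 3 + u ^ 3 - 3 * (s\<^sup>2 * u) = (s - u)\<^sup>2 * (2 * s + u)"
    by (simp add: power2_eq_square power3_eq_cube algebra_simps)
  have "0 \<le> (s - u)\<^sup>2 * (2 * s + u)" using assms by simp
  with eq show "s\<^sup>2 * u \<le> (2 * s ^ 3 + u ^ 3) / 3" by simp
  assume "s \<noteq> u"
  with assms have "0 < 2 * s + u" by (cases "s = 0") auto
  with \<open>s \<noteq> u\<close> have "0 < (s - u)\<^sup>2 * (2 * s + u)" by simp
  with eq show "s\<^sup>2 * u < (2 * s ^ 3 + u ^ 3) / 3" by simp
qed

text \<open>
  Applied with \<open>s ^ 3 = p y\<close> and \<open>t = y + 1\<close>, this makes \<open>(p y) powr (2/3)\<close>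
  summable over \<open>y\<close> for every probability \<open>p\<close> on the natural numbers with a finite first
  moment.
\<close>

lemma square_le_cube_weight:
  fixes s t :: real
  assumes "0 \<le> s" "0 < t"
  shows "s\<^sup>2 \<le> s ^ 3 * t + 1 / t\<^sup>2"
proof (cases "1 \<le> s * t")
  case True
  then have "s\<^sup>2 * 1 \<le> s\<^sup>2 * (s * t)" by (intro mult_left_mono) auto
  also have "\<dots> \<le> s ^ 3 * t + 1 / t\<^sup>2" by (simp add: power2_eq_square power3_eq_cube)
  finally show ?thesis by simp
next
  case False
  then have "s \<le> 1 / t" using assms by (simp add: field_simps)
  then have "s\<^sup>2 \<le> (1 / t)\<^sup>2" using assms by (intro power_mono) auto
  then show ?thesis using assms by (simp add: power_divide add_increasing)
qed

text \<open>
  The summand \<open>p powr (2/3) * q powr (1/3)\<close> of a Hellinger-type affinity. The symmetric choice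
  \<open>1/2\<close> of the exponents would not do: with \<open>q\<close> replaced by the trivial bound 1,
  summability has to come from the first moment of \<open>p\<close>, which suffices only if the exponent of
  \<open>q\<close> is below \<open>1/2\<close>.
\<close>

definition tilted :: "real \<Rightarrow> real \<Rightarrow> ennreal" where
  "tilted p q = ennreal ((root 3 p)\<^sup>2 * root 3 q)"

context site_law begin

lemma step_prob_le_1: "step_prob \<mu> x y \<le> 1"
  using pmf_le_1[of "step_pmf \<mu> x" y] by (simp add: pmf_step_pmf)

lemma nn_step_prob_total: "(\<integral>\<^sup>+y. ennreal (step_prob \<mu> x y) \<partial>count_space UNIV) = 1"
  using nn_integral_pmf[where p = "step_pmf \<mu> x" and A = UNIV] by (simp add: pmf_step_pmf measure_pmf.emeasure_space_1[simplified])

text \<open>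
  The worst case, in which nothing is known about the competing transition probability beyond being at most 1. The
  growth in \<open>x\<close> is harmless, since it is beaten by \<open>exp (c * \<tau> * x)\<close>.
\<close>

lemma affinity_growth:
  assumes "mean_odds \<le> 1"
  shows "(\<integral>\<^sup>+y. tilted (step_prob \<mu> x y) 1 \<partial>count_space UNIV) \<le> ennreal (real x + (2 + pi\<^sup>2 / 6))"
proof -
  have "(\<integral>\<^sup>+y. tilted (step_prob \<mu> x y) 1 \<partial>count_space UNIV) \<le>
      (\<integral>\<^sup>+y. (ennreal (step_prob \<mu> x y) * of_nat y + ennreal (step_prob \<mu> x y)) + ennreal (1 / (real y + 1)\<^sup>2) \<partial>count_space UNIV)"
  proof (rule nn_integral_mono)
    fix y
    let ?p = "step_prob \<mu> x y"
    have p: "0 \<le> ?p" using step_prob_pos[of x y] by simp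
    then have "(root 3 ?p)\<^sup>2 \<le> ?p * (real y + 1) + 1 / (real y + 1)\<^sup>2"
      using square_le_cube_weight[of "root 3 ?p" "real y + 1"] by simp
    also have "\<dots> = ?p * real y + ?p + 1 / (real y + 1)\<^sup>2" by (simp add: algebra_simps)
    finally have "ennreal ((root 3 ?p)\<^sup>2) \<le> ennreal (?p * real y + ?p + 1 / (real y + 1)\<^sup>2)"
      by (rule ennreal_leI)
    also have "\<dots> = (ennreal ?p * of_nat y + ennreal ?p) + ennreal (1 / (real y + 1)\<^sup>2)"
      using p by (simp add: ennreal_mult ennreal_of_nat_eq_real_of_nat)
    finally show "tilted ?p 1 \<le> (ennreal ?p * of_nat y + ennreal ?p) + ennreal (1 / (real y + 1)\<^sup>2)"
      by (simp add: tilted_def)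
  qed
  also have "\<dots> = (of_nat (Suc x) * mean_odds + 1) + ennreal (pi\<^sup>2 / 6)"
  proof -
    have "(\<integral>\<^sup>+y. ennreal (step_prob \<mu> x y) * of_nat y \<partial>count_space UNIV) = of_nat (Suc x) * mean_odds"
      using mean_step_pmf[of x] by (simp add: nn_integral_measure_pmf pmf_step_pmf mean_odds_def)
    moreover have "(\<integral>\<^sup>+y. ennreal (1 / (real y + 1)\<^sup>2) \<partial>count_space UNIV) = ennreal (pi\<^sup>2 / 6)"
      unfolding nn_integral_count_space_nat
      using inverse_squares_sums by (intro suminf_ennreal_eq) (auto simp: add.commute)
    ultimately show ?thesis
      by (simp add: nn_integral_add nn_step_prob_total)
  qed
  also have "\<dots> \<le> (of_nat (Suc x) * 1 + 1) + ennreal (pi\<^sup>2 / 6)"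
    using assms by (intro add_mono mult_left_mono) auto
  also have "\<dots> = ennreal (real (Suc x) + 1 + pi\<^sup>2 / 6)"
    by (simp add: ennreal_of_nat_eq_real_of_nat del: of_nat_Suc)
  also have "\<dots> = ennreal (real x + (2 + pi\<^sup>2 / 6))"
    by (rule arg_cong[where f = ennreal]) simp
  finally show ?thesis .
qed

text \<open>
  Strictness in the inequality of arithmetic and geometric means at one \<open>y\<close> is enough, and such a
  \<open>y\<close> exists for every \<open>x\<close> since the row \<open>x\<close> of the transition matrix alone
  determines the site law.
\<close>

lemma affinity_less_1:
  assumes "site_law \<mu>'" and "\<mu>' \<noteq> \<mu>"
  shows "(\<integral>\<^sup>+y. tilted (step_prob \<mu> x y) (step_prob \<mu>' x y) \<partial>count_space UNIV) < 1"
proof -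
  interpret B: site_law \<mu>' by fact
  let ?p = "step_prob \<mu> x" and ?q = "step_prob \<mu>' x"
  have p: "0 < ?p y" and q: "0 < ?q y" for y
    using step_prob_pos B.step_prob_pos by auto
  obtain z where z: "?p z \<noteq> ?q z"
    using moments_determine_site_law[of \<mu>' \<mu> x] assms site_law_axioms by metis
  define d where "d = (2 * ?p z + ?q z) / 3 - (root 3 (?p z))\<^sup>2 * root 3 (?q z)"
  have d: "0 < d"
    using weighted_AM_GM_cube(2)[of "root 3 (?p z)" "root 3 (?q z)"] p[of z] q[of z] z
    by (simp add: d_def less_imp_le)
  have "(\<integral>\<^sup>+y. tilted (?p y) (?q y) \<partial>count_space UNIV) + ennreal d =
      (\<integral>\<^sup>+y. tilted (?p y) (?q y) + ennreal d * indicator {z} y \<partial>count_space UNIV)"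
    by (subst nn_integral_add) (simp_all add: nn_integral_cmult_indicator)
  also have "\<dots> \<le> (\<integral>\<^sup>+y. ennreal (2 / 3) * ennreal (?p y) + ennreal (1 / 3) * ennreal (?q y) \<partial>count_space UNIV)"
  proof (rule nn_integral_mono)
    fix y
    have nn: "0 \<le> (root 3 (?p y))\<^sup>2 * root 3 (?q y)"
      using p[of y] q[of y] by simp
    have "(root 3 (?p y))\<^sup>2 * root 3 (?q y) + d * indicator {z} y \<le> (2 * ?p y + ?q y) / 3"
      using weighted_AM_GM_cube(1)[of "root 3 (?p y)" "root 3 (?q y)"] p[of y] q[of y]
      by (cases "y = z") (auto simp: d_def less_imp_le)
    then have "ennreal ((root 3 (?p y))\<^sup>2 * root 3 (?q y) + d * indicator {z} y) \<le> ennreal (2 / 3 * ?p y + 1 / 3 * ?q y)"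
      by (intro ennreal_leI) simp
    also have "ennreal ((root 3 (?p y))\<^sup>2 * root 3 (?q y) + d * indicator {z} y) =
        tilted (?p y) (?q y) + ennreal d * indicator {z} y"
      using nn d by (auto simp: tilted_def indicator_def)
    also have "ennreal (2 / 3 * ?p y + 1 / 3 * ?q y) = ennreal (2 / 3) * ennreal (?p y) + ennreal (1 / 3) * ennreal (?q y)"
      using p[of y] q[of y] by (subst ennreal_plus) (auto simp: ennreal_mult[symmetric])
    finally show "tilted (?p y) (?q y) + ennreal d * indicator {z} y \<le> ennreal (2 / 3) * ennreal (?p y) + ennreal (1 / 3) * ennreal (?q y)" .
  qed
  also have "\<dots> = ennreal (2 / 3) + ennreal (1 / 3)"
    by (simp add: nn_integral_add nn_integral_cmult nn_step_prob_total B.nn_step_prob_total)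
  also have "\<dots> = 1"
    by (subst ennreal_plus[symmetric]) auto
  finally have "(\<integral>\<^sup>+y. tilted (?p y) (?q y) \<partial>count_space UNIV) + ennreal d \<le> 1" .
  moreover have "a < 1" if "a + ennreal d \<le> 1" for a
  proof -
    have "a \<noteq> top" using that by (auto simp: top_unique)
    then obtain r where r: "a = ennreal r" "0 \<le> r" by (cases a) auto
    have "ennreal (r + d) \<le> ennreal 1" using that r d by simp
    then have "r + d \<le> 1" by (subst (asm) ennreal_le_iff) auto
    then show ?thesis using r d by (simp add: ennreal_less_one_iff)
  qed
  ultimately show ?thesis by blast
qed

text \<open>
  An upper bound for the transition probabilities at all parameters near that of \<open>\<mu>'\<close>: continuity
  is used only in a finite box, and outside it the trivial bound.
\<close>

definition envelope :: "real measure \<Rightarrow> nat \<Rightarrow> nat \<Rightarrow> nat \<Rightarrow> nat \<Rightarrow> real" where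
  "envelope \<mu>' X m x y = (if x < X \<and> y < m then step_prob \<mu>' x y + 1 / real (Suc m) else 1)"

lemma envelope_affinity_tendsto:
  assumes "site_law \<mu>'" and "mean_odds \<le> 1" and "x < X"
  shows "(\<lambda>m. \<integral>\<^sup>+y. tilted (step_prob \<mu> x y) (envelope \<mu>' X m x y) \<partial>count_space UNIV)
    \<longlonglongrightarrow> (\<integral>\<^sup>+y. tilted (step_prob \<mu> x y) (step_prob \<mu>' x y) \<partial>count_space UNIV)"
proof (rule nn_integral_dominated_convergence[where w = "\<lambda>y. ennreal (root 3 2) * tilted (step_prob \<mu> x y) 1"])
  interpret B: site_law \<mu>' by fact
  show "(\<integral>\<^sup>+y. ennreal (root 3 2) * tilted (step_prob \<mu> x y) 1 \<partial>count_space UNIV) < \<infinity>"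
    using le_less_trans[OF affinity_growth[OF assms(2), of x] ennreal_less_top]
    by (simp add: nn_integral_cmult ennreal_mult_less_top)
  show "AE y in count_space UNIV. tilted (step_prob \<mu> x y) (envelope \<mu>' X m x y) \<le> ennreal (root 3 2) * tilted (step_prob \<mu> x y) 1" for m
  proof (rule AE_I2)
    fix y
    have "envelope \<mu>' X m x y \<le> 2"
      using add_mono[OF B.step_prob_le_1[of x y], of "1 / real (Suc m)" 1] by (auto simp: envelope_def)
    then have "(root 3 (step_prob \<mu> x y))\<^sup>2 * root 3 (envelope \<mu>' X m x y) \<le> root 3 2 * (root 3 (step_prob \<mu> x y))\<^sup>2"
      by (subst mult.commute) (intro mult_right_mono, auto)
    then show "tilted (step_prob \<mu> x y) (envelope \<mu>' X m x y) \<le> ennreal (root 3 2) * tilted (step_prob \<mu> x y) 1"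
      by (simp add: tilted_def ennreal_mult[symmetric] ennreal_leI)
  qed
  show "AE y in count_space UNIV. (\<lambda>m. tilted (step_prob \<mu> x y) (envelope \<mu>' X m x y)) \<longlonglongrightarrow> tilted (step_prob \<mu> x y) (step_prob \<mu>' x y)"
  proof (rule AE_I2)
    fix y
    have "(\<lambda>m. step_prob \<mu>' x y + 1 / real (Suc m)) \<longlonglongrightarrow> step_prob \<mu>' x y"
      using tendsto_add[OF tendsto_const lim_inverse_n'[THEN LIMSEQ_Suc]] by simp
    moreover have "\<forall>\<^sub>F m in sequentially. step_prob \<mu>' x y + 1 / real (Suc m) = envelope \<mu>' X m x y"
      using eventually_gt_at_top[of y] by eventually_elim (simp add: envelope_def assms(3))
    ultimately have "(\<lambda>m. envelope \<mu>' X m x y) \<longlonglongrightarrow> step_prob \<mu>' x y"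
      by (rule Lim_transform_eventually)
    then show "(\<lambda>m. tilted (step_prob \<mu> x y) (envelope \<mu>' X m x y)) \<longlonglongrightarrow> tilted (step_prob \<mu> x y) (step_prob \<mu>' x y)"
      unfolding tilted_def by (intro tendsto_ennrealI tendsto_intros)
  qed
qed auto

text \<open>
  Below \<open>1 / \<tau>\<close> the affinity has to be less than \<open>exp (- c)\<close>, which a small
  \<open>c\<close> achieves as only finitely many \<open>x\<close> are concerned. For large \<open>x\<close> the
  right-hand side exceeds the trivial bound, and in between it is at least 1. So only finitely many strict
  inequalities for the limiting affinity have to be carried over to the envelope.
\<close>

lemma envelope_affinity_bound:
  assumes \<mu>': "site_law \<mu>'" "\<mu>' \<noteq> \<mu>" and R: "mean_odds \<le> 1" and \<tau>: "0 < \<tau>"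
  obtains c X m where "0 < c"
    and "\<And>x. (\<integral>\<^sup>+y. tilted (step_prob \<mu> x y) (envelope \<mu>' X m x y) \<partial>count_space UNIV) \<le> ennreal (exp (c * (\<tau> * real x - 1)))"
proof -
  let ?h = "\<lambda>x. \<integral>\<^sup>+y. tilted (step_prob \<mu> x y) (step_prob \<mu>' x y) \<partial>count_space UNIV"
  obtain X0 :: nat where X0: "1 / \<tau> < real X0" using reals_Archimedean2 by blast
  define b where "b = Max (?h ` {..X0})"
  have "b < 1"
    unfolding b_def using affinity_less_1[OF \<mu>'] by (subst Max_less_iff) auto
  then obtain r where r: "b = ennreal r" "0 \<le> r" "r < 1"
    by (cases b) (auto simp: ennreal_less_one_iff)
  \<comment> \<open>\<open>exp (- c)\<close> is to lie strictly between the largest affinity \<open>r\<close> on \<open>{..X0}\<close> and 1.\<close>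
  define c where "c = - ln ((r + 1) / 2)"
  have c: "0 < c" "exp (- c) = (r + 1) / 2"
    using r by (auto simp: c_def)
  have small: "?h x < ennreal (exp (- c))" if "x \<le> X0" for x
  proof -
    have "?h x \<le> b" unfolding b_def using that by (intro Max_ge) auto
    also have "b < ennreal (exp (- c))" using r c by (simp add: ennreal_less_iff)
    finally show ?thesis .
  qed
  have "\<forall>\<^sub>F x in sequentially. real x + (2 + pi\<^sup>2 / 6) \<le> exp (c * (\<tau> * real x - 1))"
    using c(1) \<tau> by real_asymp
  then obtain X where X: "\<And>x. X \<le> x \<Longrightarrow> real x + (2 + pi\<^sup>2 / 6) \<le> exp (c * (\<tau> * real x - 1))"
    by (auto simp: eventually_sequentially)
  have "\<forall>\<^sub>F m in sequentially. \<forall>x\<in>{..<X}.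
      (\<integral>\<^sup>+y. tilted (step_prob \<mu> x y) (envelope \<mu>' X m x y) \<partial>count_space UNIV) < ennreal (exp (c * (\<tau> * real x - 1)))"
  proof (intro eventually_ball_finite ballI)
    fix x assume "x \<in> {..<X}"
    have "?h x < ennreal (exp (c * (\<tau> * real x - 1)))"
    proof (cases "x \<le> X0")
      case True
      have "- c \<le> c * (\<tau> * real x - 1)" using c(1) \<tau> by (simp add: algebra_simps)
      then have "ennreal (exp (- c)) \<le> ennreal (exp (c * (\<tau> * real x - 1)))" by (intro ennreal_leI) simp
      then show ?thesis using small[OF True] by (rule less_le_trans[rotated])
    next
      case False
      then have "1 / \<tau> \<le> real x" using X0 by simp
      then have "0 \<le> c * (\<tau> * real x - 1)" using c(1) \<tau> by (simp add: field_simps)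
      then have "1 \<le> ennreal (exp (c * (\<tau> * real x - 1)))" by simp
      then show ?thesis using affinity_less_1[OF \<mu>', of x] by (rule less_le_trans[rotated])
    qed
    then show "\<forall>\<^sub>F m in sequentially. (\<integral>\<^sup>+y. tilted (step_prob \<mu> x y) (envelope \<mu>' X m x y) \<partial>count_space UNIV) < ennreal (exp (c * (\<tau> * real x - 1)))"
      using envelope_affinity_tendsto[OF \<mu>'(1) R, of x X] \<open>x \<in> {..<X}\<close> by (auto dest: order_tendstoD(2))
  qed simp
  then obtain m where m: "\<And>x. x < X \<Longrightarrow>
      (\<integral>\<^sup>+y. tilted (step_prob \<mu> x y) (envelope \<mu>' X m x y) \<partial>count_space UNIV) < ennreal (exp (c * (\<tau> * real x - 1)))"
    by (auto simp: eventually_sequentially)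
  have "(\<integral>\<^sup>+y. tilted (step_prob \<mu> x y) (envelope \<mu>' X m x y) \<partial>count_space UNIV) \<le> ennreal (exp (c * (\<tau> * real x - 1)))" for x
  proof (cases "x < X")
    case True
    then show ?thesis using m[of x] by simp
  next
    case False
    then have "(\<integral>\<^sup>+y. tilted (step_prob \<mu> x y) (envelope \<mu>' X m x y) \<partial>count_space UNIV) \<le> ennreal (real x + (2 + pi\<^sup>2 / 6))"
      using affinity_growth[OF R, of x] by (simp add: envelope_def)
    also have "\<dots> \<le> ennreal (exp (c * (\<tau> * real x - 1)))"
      using X[of x] False by (intro ennreal_leI) simp
    finally show ?thesis .
  qed
  with c(1) show ?thesis by (rule that)
qed

end

section \<open>Likelihood ratios along the chain\<close>

primrec chain_loglik :: "real measure \<Rightarrow> nat list \<Rightarrow> real" where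
  "chain_loglik \<mu> [] = 0"
| "chain_loglik \<mu> (y # l) = log_moment \<mu> (last_state l) y + chain_loglik \<mu> l"

lemma chain_loglik_eq: "chain_loglik \<mu> l = (\<Sum>j<length l. log_moment \<mu> (entry l (Suc j)) (entry l j))"
  by (induction l) (simp_all add: sum.lessThan_Suc_shift entry_Cons del: sum.lessThan_Suc)

lemma log_likelihood_eq_chain_loglik:
  "log_likelihood \<nu> X n \<theta> = chain_loglik (\<nu> \<theta>) (left_profile n X)"
proof -
  have "entry (left_profile n X) j = left_steps X n (int j)" if "j \<le> n" for j
    using that by (cases "j = n") (auto simp: entry_def left_profile_def)
  then show ?thesis
    by (simp add: log_likelihood_def chain_loglik_eq left_profile_def) (simp add: add.commute left_profile_def[symmetric])
qed

primrec path_weight :: "(nat \<Rightarrow> nat \<Rightarrow> ennreal) \<Rightarrow> nat list \<Rightarrow> ennreal" where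
  "path_weight w [] = 1"
| "path_weight w (y # l) = w (last_state l) y * path_weight w l"

lemma length_chain_pmf: "l \<in> set_pmf (chain_pmf \<mu> n) \<Longrightarrow> length l = n"
  by (induction n arbitrary: l) auto

text \<open>
  A product of factors with conditional mean at most 1 is a supermartingale.
\<close>

lemma nn_integral_path_weight_le:
  assumes "\<And>x. (\<integral>\<^sup>+y. w x y \<partial>step_pmf \<mu> x) \<le> 1"
  shows "(\<integral>\<^sup>+l. path_weight w l \<partial>chain_pmf \<mu> n) \<le> 1"
proof (induction n)
  case (Suc n)
  have "(\<integral>\<^sup>+l. path_weight w l \<partial>chain_pmf \<mu> (Suc n)) =
      (\<integral>\<^sup>+l. (\<integral>\<^sup>+y. w (last_state l) y \<partial>step_pmf \<mu> (last_state l)) * path_weight w l \<partial>chain_pmf \<mu> n)"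
    by (simp add: nn_integral_multc)
  also have "\<dots> \<le> (\<integral>\<^sup>+l. 1 * path_weight w l \<partial>chain_pmf \<mu> n)"
    by (intro nn_integral_mono mult_right_mono assms) auto
  finally show ?case using Suc by simp
qed simp

lemma sum_list_tl_eq: "sum_list l = last_state l + sum_list (tl l)"
  by (cases l) auto

context site_law begin

text \<open>
  The hypothesis says that the mean of the chain cannot leave the interval up to \<open>M\<close>: from a mean
  \<open>m\<close> it moves to \<open>(m + 1) * mean_odds\<close>.
\<close>

lemma nn_integral_last_state_le:
  assumes "(M + 1) * mean_odds \<le> M"
  shows "(\<integral>\<^sup>+l. of_nat (last_state l) \<partial>chain_pmf \<mu> n) \<le> M"
proof (induction n)
  case (Suc n)
  have "(\<integral>\<^sup>+l. of_nat (last_state l) \<partial>chain_pmf \<mu> (Suc n)) =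
      (\<integral>\<^sup>+l. (of_nat (last_state l) + 1) * mean_odds \<partial>chain_pmf \<mu> n)"
    by (simp add: mean_step_pmf mean_odds_def add.commute)
  also have "\<dots> = ((\<integral>\<^sup>+l. of_nat (last_state l) \<partial>chain_pmf \<mu> n) + 1) * mean_odds"
    by (simp add: nn_integral_multc nn_integral_add measure_pmf.emeasure_space_1[simplified])
  also have "\<dots> \<le> (M + 1) * mean_odds"
    using Suc by (intro mult_right_mono add_mono) auto
  finally show ?case using assms by (rule order_trans)
qed simp

lemma nn_integral_sum_list_le:
  assumes "(M + 1) * mean_odds \<le> M"
  shows "(\<integral>\<^sup>+l. of_nat (sum_list l) \<partial>chain_pmf \<mu> n) \<le> of_nat n * M"
proof (induction n)
  case (Suc n)
  let ?p = "chain_pmf \<mu> (Suc n)"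
  have tl: "(\<integral>\<^sup>+l. f (tl l) \<partial>?p) = (\<integral>\<^sup>+l. f l \<partial>chain_pmf \<mu> n)" for f :: "nat list \<Rightarrow> ennreal"
    by (simp add: measure_pmf.emeasure_space_1[simplified])
  have "(\<integral>\<^sup>+l. of_nat (sum_list l) \<partial>?p) = (\<integral>\<^sup>+l. of_nat (last_state l) + of_nat (sum_list (tl l)) \<partial>?p)"
    by (subst sum_list_tl_eq) simp
  also have "\<dots> = (\<integral>\<^sup>+l. of_nat (last_state l) \<partial>?p) + (\<integral>\<^sup>+l. of_nat (sum_list (tl l)) \<partial>?p)"
    by (rule nn_integral_add) auto
  also have "\<dots> \<le> M + of_nat n * M"
    using Suc by (intro add_mono nn_integral_last_state_le assms) (simp only: tl[of "\<lambda>l. of_nat (sum_list l)"])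
  finally show ?case by (simp add: distrib_right)
qed simp

text \<open>
  The sum in the exponent runs over the states from which a step is made; these are all but the most recent one,
  whence the tail.
\<close>

lemma exp_loglik_le_path_weight:
  assumes G: "\<And>x y. step_prob \<nu>' x y \<le> G x y" and \<nu>': "site_law \<nu>'"
    and w: "\<And>x y. w x y = ennreal (root 3 (G x y / step_prob \<mu> x y) * exp (c * (1 - \<tau> * real x)))"
  shows "ennreal (exp ((chain_loglik \<nu>' l - chain_loglik \<mu> l) / 3 + c * (real (length l) - \<tau> * real (sum_list (tl l)))))
    \<le> path_weight w l"
proof (induction l)
  case (Cons y l)
  interpret B: site_law \<nu>' by fact
  define x where "x = last_state l"
  let ?d = "log_moment \<nu>' x y - log_moment \<mu> x y"
  have pos: "0 < step_prob \<mu> x y" by (rule step_prob_pos)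
  have "exp (?d / 3) = root 3 (exp ?d)"
    by (rule real_root_pos_unique[symmetric]) (auto simp: exp_of_nat_mult[symmetric])
  also have "exp ?d = step_prob \<nu>' x y / step_prob \<mu> x y"
    by (simp add: step_prob_log_moment B.step_prob_log_moment exp_diff)
  also have "root 3 \<dots> \<le> root 3 (G x y / step_prob \<mu> x y)"
    using G[of x y] pos by (simp add: divide_right_mono)
  finally have "exp (?d / 3) * exp (c * (1 - \<tau> * real x)) \<le> root 3 (G x y / step_prob \<mu> x y) * exp (c * (1 - \<tau> * real x))"
    by (rule mult_right_mono) simp
  then have head: "ennreal (exp (?d / 3 + c * (1 - \<tau> * real x))) \<le> w x y"
    unfolding w by (intro ennreal_leI) (simp add: exp_add)
  have "(chain_loglik \<nu>' (y # l) - chain_loglik \<mu> (y # l)) / 3 + c * (real (length (y # l)) - \<tau> * real (sum_list (tl (y # l)))) =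
      (?d / 3 + c * (1 - \<tau> * real x)) +
      ((chain_loglik \<nu>' l - chain_loglik \<mu> l) / 3 + c * (real (length l) - \<tau> * real (sum_list (tl l))))"
    using sum_list_tl_eq[of l] by (simp add: x_def field_simps)
  then show ?case
    using mult_mono[OF head Cons] by (simp add: exp_add ennreal_mult x_def)
qed simp

text \<open>
  Each step of the chain multiplies the weight by the cube root of the envelope's likelihood ratio and by
  \<open>exp (c * (1 - \<tau> * x))\<close>; the affinity bound says that this has conditional mean at most 1. If
  some \<open>\<rho>\<close> below the envelope is at least as likely as \<open>\<mu>\<close>, the likelihood
  ratios contribute a factor at least 1, and if moreover the states of the chain have a small sum, the
  exponentials contribute \<open>exp (c * n / 2)\<close>. Markov's inequality concludes.
\<close>

lemma local_likelihood_bound: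
  assumes \<nu>': "site_law \<nu>'" "\<nu>' \<noteq> \<mu>" and R: "mean_odds \<le> 1" and \<tau>: "0 < \<tau>"
  obtains c X m where "0 < c"
    and "\<And>n S. (\<And>\<rho>. \<rho> \<in> S \<Longrightarrow> site_law \<rho> \<and> (\<forall>x<X. \<forall>y<m. step_prob \<rho> x y \<le> step_prob \<nu>' x y + 1 / real (Suc m))) \<Longrightarrow>
      emeasure (chain_pmf \<mu> n) {l. 2 * \<tau> * real (sum_list l) \<le> real n \<and> (\<exists>\<rho>\<in>S. chain_loglik \<mu> l \<le> chain_loglik \<rho> l)}
        \<le> ennreal (exp (- (c / 2) * real n))"
proof -
  interpret B: site_law \<nu>' by fact
  obtain c X m where c: "0 < c" and env: "\<And>x. (\<integral>\<^sup>+y. tilted (step_prob \<mu> x y) (envelope \<nu>' X m x y) \<partial>count_space UNIV)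
      \<le> ennreal (exp (c * (\<tau> * real x - 1)))"
    using envelope_affinity_bound[OF \<nu>' R \<tau>] by metis
  define G where "G = envelope \<nu>' X m"
  define w where "w x y = ennreal (root 3 (G x y / step_prob \<mu> x y) * exp (c * (1 - \<tau> * real x)))" for x y
  have G_nn: "0 \<le> G x y" for x y
    using B.step_prob_pos[of x y] by (simp add: G_def envelope_def add_nonneg_nonneg less_imp_le)
  have w1: "(\<integral>\<^sup>+y. w x y \<partial>step_pmf \<mu> x) \<le> 1" for x
  proof -
    have "ennreal (step_prob \<mu> x y) * w x y = ennreal (exp (c * (1 - \<tau> * real x))) * tilted (step_prob \<mu> x y) (G x y)" for y
    proof -
      define s where "s = root 3 (step_prob \<mu> x y)"
      have s: "0 < s" "step_prob \<mu> x y = s ^ 3"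
        using step_prob_pos[of x y] by (simp_all add: s_def less_imp_le)
      have "s ^ 3 * (root 3 (G x y) / s * e) = e * (s\<^sup>2 * root 3 (G x y))" for e
        using s(1) by (simp add: power2_eq_square power3_eq_cube)
      then have "step_prob \<mu> x y * (root 3 (G x y / step_prob \<mu> x y) * exp (c * (1 - \<tau> * real x))) =
          exp (c * (1 - \<tau> * real x)) * ((root 3 (step_prob \<mu> x y))\<^sup>2 * root 3 (G x y))"
        unfolding real_root_divide s_def[symmetric] by (simp only: s(2))
      then show ?thesis
        using step_prob_pos[of x y] G_nn[of x y]
        by (simp add: w_def tilted_def ennreal_mult[symmetric] less_imp_le)
    qed
    then have "(\<integral>\<^sup>+y. w x y \<partial>step_pmf \<mu> x) =
        ennreal (exp (c * (1 - \<tau> * real x))) * (\<integral>\<^sup>+y. tilted (step_prob \<mu> x y) (G x y) \<partial>count_space UNIV)"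
      by (simp add: nn_integral_measure_pmf pmf_step_pmf nn_integral_cmult)
    also have "\<dots> \<le> ennreal (exp (c * (1 - \<tau> * real x))) * ennreal (exp (c * (\<tau> * real x - 1)))"
      unfolding G_def by (intro mult_left_mono env) auto
    also have "\<dots> = 1"
      by (simp add: ennreal_mult[symmetric] exp_add[symmetric] algebra_simps)
    finally show ?thesis .
  qed
  show ?thesis
  proof (rule that[OF c])
    fix n S
    assume S: "\<And>\<rho>. \<rho> \<in> S \<Longrightarrow> site_law \<rho> \<and> (\<forall>x<X. \<forall>y<m. step_prob \<rho> x y \<le> step_prob \<nu>' x y + 1 / real (Suc m))"
    define A where "A = {l. 2 * \<tau> * real (sum_list l) \<le> real n \<and> (\<exists>\<rho>\<in>S. chain_loglik \<mu> l \<le> chain_loglik \<rho> l)}"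
    have weight: "ennreal (exp (c / 2 * real n)) * indicator A l \<le> path_weight w l" if "l \<in> set_pmf (chain_pmf \<mu> n)" for l
    proof (cases "l \<in> A")
      case True
      then obtain \<rho> where \<rho>: "\<rho> \<in> S" "chain_loglik \<mu> l \<le> chain_loglik \<rho> l" and sum: "2 * \<tau> * real (sum_list l) \<le> real n"
        by (auto simp: A_def)
      interpret P: site_law \<rho> using S[OF \<rho>(1)] by simp
      have "step_prob \<rho> x y \<le> G x y" for x y
        using S[OF \<rho>(1)] P.step_prob_le_1[of x y] by (auto simp: G_def envelope_def)
      note bound = exp_loglik_le_path_weight[OF this P.site_law_axioms w_def, of l]
      have "\<tau> * real (sum_list (tl l)) \<le> \<tau> * real (sum_list l)"
        using \<tau> sum_list_tl_eq[of l] by simp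
      with sum have "real n / 2 \<le> real n - \<tau> * real (sum_list (tl l))" by simp
      then have "c * (real n / 2) \<le> c * (real n - \<tau> * real (sum_list (tl l)))"
        using c by (intro mult_left_mono) auto
      moreover have "0 \<le> (chain_loglik \<rho> l - chain_loglik \<mu> l) / 3" using \<rho>(2) by simp
      ultimately have "c / 2 * real n \<le> (chain_loglik \<rho> l - chain_loglik \<mu> l) / 3 + c * (real (length l) - \<tau> * real (sum_list (tl l)))"
        unfolding length_chain_pmf[OF that] by linarith
      then have "ennreal (exp (c / 2 * real n)) \<le> ennreal (exp ((chain_loglik \<rho> l - chain_loglik \<mu> l) / 3 + c * (real (length l) - \<tau> * real (sum_list (tl l)))))"
        by (intro ennreal_leI) simp
      from order_trans[OF this bound] True show ?thesis by simp
    qed simp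
    have "ennreal (exp (c / 2 * real n)) * emeasure (chain_pmf \<mu> n) A = (\<integral>\<^sup>+l. ennreal (exp (c / 2 * real n)) * indicator A l \<partial>chain_pmf \<mu> n)"
      by (simp add: nn_integral_cmult_indicator)
    also have "\<dots> \<le> (\<integral>\<^sup>+l. path_weight w l \<partial>chain_pmf \<mu> n)"
      using weight by (intro nn_integral_mono_AE AE_pmfI)
    also have "\<dots> \<le> 1"
      by (rule nn_integral_path_weight_le[OF w1])
    finally have "ennreal (exp (- (c / 2) * real n)) * (ennreal (exp (c / 2 * real n)) * emeasure (chain_pmf \<mu> n) A) \<le> ennreal (exp (- (c / 2) * real n)) * 1"
      by (rule mult_left_mono) simp
    then show "emeasure (chain_pmf \<mu> n) A \<le> ennreal (exp (- (c / 2) * real n))"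
      by (simp add: mult.assoc[symmetric] ennreal_mult[symmetric] exp_add[symmetric])
  qed
qed

text \<open>
  By compactness, finitely many of the local bounds cover \<open>K\<close>. The probability of the exceptional
  event of a large sum of states has no bound that decays, but the event does not depend on the parameter either:
  it is paid for only once, and \<open>\<tau>\<close> is chosen before the cover so as to make it small.
\<close>

lemma chain_likelihood_separated:
  fixes \<nu> :: "'p :: topological_space \<Rightarrow> real measure"
  assumes K: "compact K" and law: "\<And>\<theta>. \<theta> \<in> K \<Longrightarrow> site_law (\<nu> \<theta>)" and neq: "\<And>\<theta>. \<theta> \<in> K \<Longrightarrow> \<nu> \<theta> \<noteq> \<mu>"
    and cont: "\<And>x y. continuous_on K (\<lambda>\<theta>. log_moment (\<nu> \<theta>) x y)" and R: "mean_odds < 1"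
  shows "(\<lambda>n. measure (chain_pmf \<mu> n) {l. \<exists>\<theta>\<in>K. chain_loglik \<mu> l \<le> chain_loglik (\<nu> \<theta>) l}) \<longlonglongrightarrow> 0"
proof (rule order_tendstoI)
  fix \<delta> :: real assume \<delta>: "0 < \<delta>"
  obtain r where r: "mean_odds = ennreal r" "0 \<le> r"
    using R by (cases mean_odds) auto
  with R have r1: "r < 1" by simp
  \<comment> \<open>The fixed point of the mean of the chain.\<close>
  define M where "M = r / (1 - r)"
  have M: "0 \<le> M" "(M + 1) * r = M"
    using r r1 by (simp_all add: M_def field_simps)
  have M': "(ennreal M + 1) * mean_odds \<le> ennreal M"
  proof -
    have "(ennreal M + 1) * mean_odds = ennreal (M + 1) * ennreal r"
      using M(1) by (simp add: r(1))
    also have "\<dots> = ennreal M"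
      using M r(2) by (simp add: ennreal_mult[symmetric] del: ennreal_plus)
    finally show ?thesis by simp
  qed
  define \<tau> where "\<tau> = \<delta> / (4 * (M + 1))"
  have \<tau>: "0 < \<tau>" "2 * \<tau> * M \<le> \<delta> / 2"
    using M(1) \<delta> by (simp_all add: \<tau>_def field_simps)
  let ?T = "\<lambda>n. {l. real n < 2 * \<tau> * real (sum_list l)}"
  let ?E = "\<lambda>n V. {l. 2 * \<tau> * real (sum_list l) \<le> real n \<and> (\<exists>\<theta>\<in>V. chain_loglik \<mu> l \<le> chain_loglik (\<nu> \<theta>) l)}"
  \<comment> \<open>Markov's inequality, as the mean of the sum is at most \<open>n * M\<close>.\<close>
  have long: "measure (chain_pmf \<mu> n) (?T n) \<le> \<delta> / 2" if "n \<ge> 1" for n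
  proof -
    have "ennreal (real n) * emeasure (chain_pmf \<mu> n) (?T n) = (\<integral>\<^sup>+l. ennreal (real n) * indicator (?T n) l \<partial>chain_pmf \<mu> n)"
      by (simp add: nn_integral_cmult_indicator)
    also have "\<dots> \<le> (\<integral>\<^sup>+l. ennreal (2 * \<tau>) * of_nat (sum_list l) \<partial>chain_pmf \<mu> n)"
      using \<tau>(1) by (intro nn_integral_mono)
        (auto simp: indicator_def ennreal_of_nat_eq_real_of_nat ennreal_mult[symmetric] intro!: ennreal_leI)
    also have "\<dots> \<le> ennreal (2 * \<tau>) * (of_nat n * ennreal M)"
      by (subst nn_integral_cmult) (auto intro!: mult_left_mono nn_integral_sum_list_le M')
    also have "\<dots> = ennreal (2 * \<tau> * (real n * M))"
      using \<tau>(1) M(1) by (simp add: ennreal_of_nat_eq_real_of_nat ennreal_mult)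
    finally have "ennreal (real n * measure (chain_pmf \<mu> n) (?T n)) \<le> ennreal (2 * \<tau> * (real n * M))"
      by (simp add: measure_pmf.emeasure_eq_measure ennreal_mult)
    then have "real n * measure (chain_pmf \<mu> n) (?T n) \<le> real n * (2 * \<tau> * M)"
      using \<tau>(1) M(1) by (subst (asm) ennreal_le_iff) (auto simp: mult_ac)
    then have "measure (chain_pmf \<mu> n) (?T n) \<le> 2 * \<tau> * M"
      using that by simp
    then show ?thesis using \<tau>(2) by simp
  qed
  define decay where "decay \<theta> c U \<longleftrightarrow> 0 < c \<and> open U \<and> \<theta> \<in> U \<and>
      (\<forall>n. measure (chain_pmf \<mu> n) (?E n (K \<inter> U)) \<le> exp (- (c / 2) * real n))" for \<theta> c U
  have "\<exists>c U. decay \<theta> c U" if \<theta>: "\<theta> \<in> K" for \<theta>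
  proof -
    obtain c X m where c: "0 < c" and bound: "\<And>n S.
        (\<And>\<rho>. \<rho> \<in> S \<Longrightarrow> site_law \<rho> \<and> (\<forall>x<X. \<forall>y<m. step_prob \<rho> x y \<le> step_prob (\<nu> \<theta>) x y + 1 / real (Suc m))) \<Longrightarrow>
        emeasure (chain_pmf \<mu> n) {l. 2 * \<tau> * real (sum_list l) \<le> real n \<and> (\<exists>\<rho>\<in>S. chain_loglik \<mu> l \<le> chain_loglik \<rho> l)}
          \<le> ennreal (exp (- (c / 2) * real n))"
      using local_likelihood_bound[OF law[OF \<theta>] neq[OF \<theta>] less_imp_le[OF R] \<tau>(1)] by blast
    have "\<forall>\<^sub>F \<theta>' in at \<theta> within K. \<forall>x\<in>{..<X}. \<forall>y\<in>{..<m}. step_prob (\<nu> \<theta>') x y < step_prob (\<nu> \<theta>) x y + 1 / real (Suc m)"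
    proof (intro eventually_ball_finite ballI finite_lessThan)
      fix x y
      have "continuous_on K (\<lambda>\<theta>. step_prob (\<nu> \<theta>) x y)"
      proof (subst continuous_on_cong[OF refl])
        show "step_prob (\<nu> \<theta>) x y = real ((x + y) choose y) * exp (log_moment (\<nu> \<theta>) x y)" if "\<theta> \<in> K" for \<theta>
          by (rule site_law.step_prob_log_moment[OF law[OF that]])
      qed (intro continuous_intros cont)
      then have "((\<lambda>\<theta>. step_prob (\<nu> \<theta>) x y) \<longlongrightarrow> step_prob (\<nu> \<theta>) x y) (at \<theta> within K)"
        using \<theta> by (simp add: continuous_on_def)
      then show "\<forall>\<^sub>F \<theta>' in at \<theta> within K. step_prob (\<nu> \<theta>') x y < step_prob (\<nu> \<theta>) x y + 1 / real (Suc m)"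
        by (rule order_tendstoD(2)) simp
    qed
    then obtain U where U: "open U" "\<theta> \<in> U" and near: "\<And>\<theta>' x y. \<theta>' \<in> U \<Longrightarrow> \<theta>' \<noteq> \<theta> \<Longrightarrow> \<theta>' \<in> K \<Longrightarrow> x < X \<Longrightarrow> y < m \<Longrightarrow>
        step_prob (\<nu> \<theta>') x y < step_prob (\<nu> \<theta>) x y + 1 / real (Suc m)"
      unfolding eventually_at_topological by (auto simp del: of_nat_Suc)
    have near': "site_law \<rho> \<and> (\<forall>x<X. \<forall>y<m. step_prob \<rho> x y \<le> step_prob (\<nu> \<theta>) x y + 1 / real (Suc m))"
      if "\<rho> \<in> \<nu> ` (K \<inter> U)" for \<rho>
    proof -
      from that obtain \<theta>' where \<theta>': "\<theta>' \<in> K" "\<theta>' \<in> U" "\<rho> = \<nu> \<theta>'" by auto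
      then show ?thesis
        using law near[of \<theta>'] by (cases "\<theta>' = \<theta>") (auto simp del: of_nat_Suc intro: less_imp_le)
    qed
    have "measure (chain_pmf \<mu> n) (?E n (K \<inter> U)) \<le> exp (- (c / 2) * real n)" for n
    proof -
      have "emeasure (chain_pmf \<mu> n) {l. 2 * \<tau> * real (sum_list l) \<le> real n \<and> (\<exists>\<rho>\<in>\<nu> ` (K \<inter> U). chain_loglik \<mu> l \<le> chain_loglik \<rho> l)}
          \<le> ennreal (exp (- (c / 2) * real n))"
        by (rule bound[OF near'])
      then show ?thesis by (simp add: measure_pmf.emeasure_eq_measure)
    qed
    with c U show ?thesis unfolding decay_def by blast
  qed
  then obtain c U where decay: "\<And>\<theta>. \<theta> \<in> K \<Longrightarrow> decay \<theta> (c \<theta>) (U \<theta>)" by metis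
  then have c: "\<And>\<theta>. \<theta> \<in> K \<Longrightarrow> 0 < c \<theta>" and U: "\<And>\<theta>. \<theta> \<in> K \<Longrightarrow> open (U \<theta>) \<and> \<theta> \<in> U \<theta>"
    and cU: "\<And>\<theta> n. \<theta> \<in> K \<Longrightarrow> measure (chain_pmf \<mu> n) (?E n (K \<inter> U \<theta>)) \<le> exp (- (c \<theta> / 2) * real n)"
    unfolding decay_def by blast+
  obtain D where D: "D \<subseteq> K" "finite D" "K \<subseteq> (\<Union>\<theta>\<in>D. U \<theta>)"
    using compactE_image[OF K, of K U] U by blast
  have "(\<lambda>n. \<Sum>\<theta>\<in>D. exp (- (c \<theta> / 2) * real n)) \<longlonglongrightarrow> (\<Sum>\<theta>\<in>D. 0)"
  proof (rule tendsto_sum)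
    fix \<theta> assume "\<theta> \<in> D"
    then have "0 < c \<theta>" using c D(1) by blast
    then show "(\<lambda>n. exp (- (c \<theta> / 2) * real n)) \<longlonglongrightarrow> 0" by real_asymp
  qed
  then have "\<forall>\<^sub>F n in sequentially. (\<Sum>\<theta>\<in>D. exp (- (c \<theta> / 2) * real n)) < \<delta> / 2"
    using \<delta> by (auto dest: order_tendstoD(2)[where a = "\<delta> / 2"])
  then show "\<forall>\<^sub>F n in sequentially. measure (chain_pmf \<mu> n) {l. \<exists>\<theta>\<in>K. chain_loglik \<mu> l \<le> chain_loglik (\<nu> \<theta>) l} < \<delta>"
    using eventually_ge_at_top[of 1]
  proof eventually_elim
    case (elim n)
    have "{l. \<exists>\<theta>\<in>K. chain_loglik \<mu> l \<le> chain_loglik (\<nu> \<theta>) l} \<subseteq> ?T n \<union> (\<Union>\<theta>\<in>D. ?E n (K \<inter> U \<theta>))"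
    proof
      fix l assume "l \<in> {l. \<exists>\<theta>\<in>K. chain_loglik \<mu> l \<le> chain_loglik (\<nu> \<theta>) l}"
      then obtain \<theta> where \<theta>: "\<theta> \<in> K" "chain_loglik \<mu> l \<le> chain_loglik (\<nu> \<theta>) l" by blast
      then obtain \<theta>' where \<theta>': "\<theta>' \<in> D" "\<theta> \<in> U \<theta>'" using D(3) by blast
      show "l \<in> ?T n \<union> (\<Union>\<theta>\<in>D. ?E n (K \<inter> U \<theta>))"
      proof (cases "l \<in> ?T n")
        case False
        then have "l \<in> ?E n (K \<inter> U \<theta>')" using \<theta> \<theta>'(2) by (auto simp: not_less)
        with \<theta>'(1) show ?thesis by blast
      qed simp
    qed
    then have "measure (chain_pmf \<mu> n) {l. \<exists>\<theta>\<in>K. chain_loglik \<mu> l \<le> chain_loglik (\<nu> \<theta>) l} \<le>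
        measure (chain_pmf \<mu> n) (?T n \<union> (\<Union>\<theta>\<in>D. ?E n (K \<inter> U \<theta>)))"
      by (intro measure_pmf.finite_measure_mono) auto
    also have "\<dots> \<le> measure (chain_pmf \<mu> n) (?T n) + measure (chain_pmf \<mu> n) (\<Union>\<theta>\<in>D. ?E n (K \<inter> U \<theta>))"
      by (rule measure_Un_le) auto
    also have "measure (chain_pmf \<mu> n) (\<Union>\<theta>\<in>D. ?E n (K \<inter> U \<theta>)) \<le> (\<Sum>\<theta>\<in>D. measure (chain_pmf \<mu> n) (?E n (K \<inter> U \<theta>)))"
      using D(2) by (intro measure_UNION_le) auto
    also have "\<dots> \<le> (\<Sum>\<theta>\<in>D. exp (- (c \<theta> / 2) * real n))"
      using D(1) cU by (intro sum_mono) blast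
    finally show ?case
      using long[OF elim(2)] elim(1) by simp
  qed
qed (auto intro: always_eventually less_le_trans[OF _ measure_nonneg])

end

section \<open>Consistency of the maximum likelihood estimator\<close>

theorem theorem2p4:
  fixes \<Theta> :: "(real ^ 'd) set"
    and \<theta>\<^sub>0 :: "real ^ 'd"
    and \<nu> :: "real ^ 'd \<Rightarrow> real measure"
    and est :: "nat \<Rightarrow> (nat \<Rightarrow> int) \<Rightarrow> real ^ 'd"
  assumes compact: "compact \<Theta>"
    and prob: "\<And>\<theta>. \<theta> \<in> \<Theta> \<Longrightarrow> prob_space (\<nu> \<theta>)"
    and sets: "\<And>\<theta>. \<theta> \<in> \<Theta> \<Longrightarrow> sets (\<nu> \<theta>) = sets unit_borel"
    and interior: "\<theta>\<^sub>0 \<in> interior \<Theta>"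
    and transient: "\<And>\<theta>. \<theta> \<in> \<Theta> \<Longrightarrow>
      integrable (env_law (\<nu> \<theta>)) (\<lambda>\<omega>. ln (odds \<omega> 0)) \<and>
      (\<integral>\<omega>. ln (odds \<omega> 0) \<partial>env_law (\<nu> \<theta>)) < 0"
    and ballistic: "\<And>\<theta>. \<theta> \<in> \<Theta> \<Longrightarrow>
      integrable (env_law (\<nu> \<theta>)) (\<lambda>\<omega>. odds \<omega> 0) \<and>
      (\<integral>\<omega>. odds \<omega> 0 \<partial>env_law (\<nu> \<theta>)) < 1"
    and continuous: "\<And>x y. continuous_on \<Theta> (\<lambda>\<theta>. log_moment (\<nu> \<theta>) x y)"
    and identifiable: "\<And>\<theta> \<theta>'. \<theta> \<in> \<Theta> \<Longrightarrow> \<theta>' \<in> \<Theta> \<Longrightarrow> \<nu> \<theta> \<noteq> \<nu> \<theta>' \<longleftrightarrow> \<theta> \<noteq> \<theta>'"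
    and log_integrable: "\<And>\<theta>. \<theta> \<in> \<Theta> \<Longrightarrow> integrable (env_law (\<nu> \<theta>)) (\<lambda>\<omega>. ln (1 - \<omega> 0))"
    and log_bounded: "bdd_below ((\<lambda>\<theta>. \<integral>\<omega>. ln (1 - \<omega> 0) \<partial>env_law (\<nu> \<theta>)) ` \<Theta>)"
    and est_measurable: "\<And>n. n \<ge> 1 \<Longrightarrow> est n \<in> borel_measurable path_space"
    and est_argmax: "\<And>n. n \<ge> 1 \<Longrightarrow>
      AE X in annealed_law (\<nu> \<theta>\<^sub>0). is_arg_max (log_likelihood \<nu> X n) (\<lambda>\<theta>. \<theta> \<in> \<Theta>) (est n X)"
  shows "\<forall>\<epsilon>>0.
    (\<lambda>n. measure (annealed_law (\<nu> \<theta>\<^sub>0)) {X \<in> space path_space. dist (est n X) \<theta>\<^sub>0 > \<epsilon>}) \<longlonglongrightarrow> 0"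
proof (intro allI impI)
  fix \<epsilon> :: real assume \<epsilon>: "0 < \<epsilon>"
  have \<theta>\<^sub>0: "\<theta>\<^sub>0 \<in> \<Theta>" using interior interior_subset by blast
  have law: "site_law (\<nu> \<theta>)" if "\<theta> \<in> \<Theta>" for \<theta>
    using prob[OF that] sets[OF that] by (simp add: site_law_def site_law_axioms_def)
  interpret L: site_law "\<nu> \<theta>\<^sub>0" by (rule law[OF \<theta>\<^sub>0])
  have R: "L.mean_odds < 1"
  proof -
    have "L.mean_odds = (\<integral>\<^sup>+\<omega>. ennreal (odds \<omega> 0) \<partial>env_law (\<nu> \<theta>\<^sub>0))"
      using L.nn_integral_env_law_prod[of "{0}" "\<lambda>_ a. ennreal ((1 - a) / a)"] L.measurable_odds
      by (simp add: L.mean_odds_def odds_def)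
    also have "\<dots> = ennreal (\<integral>\<omega>. odds \<omega> 0 \<partial>env_law (\<nu> \<theta>\<^sub>0))"
      using ballistic[OF \<theta>\<^sub>0]
      by (intro nn_integral_eq_integral) (auto intro!: AE_I2 simp: L.space_env_law odds_def less_imp_le)
    also have "\<dots> < 1"
      using ballistic[OF \<theta>\<^sub>0] by (simp add: ennreal_less_one_iff)
    finally show ?thesis .
  qed
  \<comment> \<open>An estimate further than \<open>\<epsilon>\<close> away lies in the following compact set and is at least as likely as \<open>\<theta>\<^sub>0\<close>.\<close>
  define K where "K = \<Theta> - ball \<theta>\<^sub>0 \<epsilon>"
  have K: "K \<subseteq> \<Theta>" "\<theta>\<^sub>0 \<notin> K" using \<epsilon> by (auto simp: K_def)
  define S where "S = {l. \<exists>\<theta>\<in>K. chain_loglik (\<nu> \<theta>\<^sub>0) l \<le> chain_loglik (\<nu> \<theta>) l}"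
  have lim: "(\<lambda>n. measure (chain_pmf (\<nu> \<theta>\<^sub>0) n) S) \<longlonglongrightarrow> 0"
    unfolding S_def
  proof (rule L.chain_likelihood_separated)
    show "compact K" unfolding K_def using compact by (rule compact_diff) simp
    show "site_law (\<nu> \<theta>)" if "\<theta> \<in> K" for \<theta> using law K that by blast
    show "\<nu> \<theta> \<noteq> \<nu> \<theta>\<^sub>0" if "\<theta> \<in> K" for \<theta> using identifiable[of \<theta> \<theta>\<^sub>0] K \<theta>\<^sub>0 that by blast
    show "continuous_on K (\<lambda>\<theta>. log_moment (\<nu> \<theta>) x y)" for x y
      using continuous continuous_on_subset K(1) by blast
    show "L.mean_odds < 1" by (rule R)
  qed
  let ?A = "annealed_law (\<nu> \<theta>\<^sub>0)"
  interpret A: prob_space ?A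
    by (rule prob_space_annealed_law[OF L.prob_space_axioms L.sets_site])
  have sets_A: "sets ?A = sets path_space" by (rule L.sets_annealed_law)
  have le: "measure ?A {X \<in> space path_space. dist (est n X) \<theta>\<^sub>0 > \<epsilon>} \<le> measure (chain_pmf (\<nu> \<theta>\<^sub>0) n) S" if n: "n \<ge> 1" for n
  proof -
    let ?B = "{X. (\<exists>t. X t = int n) \<and> left_profile n X \<in> S}"
    have "{X. \<forall>t. X t \<noteq> int n} \<in> null_sets ?A"
      using L.emeasure_never_reached[OF R, of n] L.never_reached_event by (auto simp: null_sets_def sets_A)
    then have "AE X in ?A. \<exists>t. X t = int n"
      by (rule AE_I') auto
    moreover have "AE X in ?A. is_arg_max (log_likelihood \<nu> X n) (\<lambda>\<theta>. \<theta> \<in> \<Theta>) (est n X)"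
      by (rule est_argmax[OF n])
    ultimately have "AE X in ?A. X \<in> {X \<in> space path_space. dist (est n X) \<theta>\<^sub>0 > \<epsilon>} \<longrightarrow> X \<in> ?B"
    proof eventually_elim
      case (elim X)
      show ?case
      proof
        assume "X \<in> {X \<in> space path_space. dist (est n X) \<theta>\<^sub>0 > \<epsilon>}"
        with elim(2) have "est n X \<in> K"
          by (auto simp: K_def is_arg_max_def dist_commute)
        moreover have "log_likelihood \<nu> X n \<theta>\<^sub>0 \<le> log_likelihood \<nu> X n (est n X)"
          using elim(2) \<theta>\<^sub>0 by (auto simp: is_arg_max_def not_less)
        ultimately show "X \<in> ?B"
          using elim(1) by (auto simp: S_def log_likelihood_eq_chain_loglik)
      qed
    qed
    then have "emeasure ?A {X \<in> space path_space. dist (est n X) \<theta>\<^sub>0 > \<epsilon>} \<le> emeasure ?A ?B"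
      by (rule emeasure_mono_AE) (simp add: sets_A L.emeasure_left_profile_chain(1))
    also have "\<dots> \<le> emeasure (chain_pmf (\<nu> \<theta>\<^sub>0) n) S"
      by (rule L.emeasure_left_profile_chain(2))
    finally show ?thesis
      by (simp add: A.emeasure_eq_measure measure_pmf.emeasure_eq_measure)
  qed
  show "(\<lambda>n. measure ?A {X \<in> space path_space. dist (est n X) \<theta>\<^sub>0 > \<epsilon>}) \<longlonglongrightarrow> 0"
    by (rule tendsto_sandwich[OF _ _ tendsto_const lim])
      (use le in \<open>auto simp: eventually_sequentially\<close>)
qed

end
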